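(* In the fixed-design setting of the context, assume $\kappa(s_*,4)>0$. Let $\widehat P\in\mathbb{R}^{m\times m}$ be any estimator of $P_{B^*}$, and let $\widetilde\Theta$ be any solution of $$\min_{\Theta\in\mathbb{R}^{p\times m}}\frac1n\left\|\mathbf Y(I_m-\widehat P)-\mathbf X\Theta\right\|_F^2+\lambda_3\|\Theta\|_{\ell_1/\ell_2},$$ with any choice of $\lambda_3\ge\bar\lambda_3$, where $$\bar\lambda_3=4\gamma_e\sqrt{\max_{1\le j\le p}\widehat\Sigma_{jj}}\ \frac{\sqrt m+\sqrt{2\log(p/\epsilon)}}{\sqrt n}.$$ Then, on the event $\{\|\widehat P-P_{B^*}\|_F\lesssim\xi_n\}$ for some proper sequence $\xi_n$, with probability $1-\epsilon-2e^{-cK}$ for some constant $c>0$, one has $$\|\widetilde\Theta-\Theta^*\|_{\ell_1/\ell_2}\lesssim\max\left\{\lambda_3,\ \frac{(\widetilde\lambda_3)^2}{\lambda_3}\right\}\frac{s_*}{\kappa^2(s_*,4)},$$ where $$\widetilde\lambda_3=\left\{\frac1{\sqrt n}\|\mathbf XF^*\|_{op}+\sqrt{\Lambda_1}\left(1+\sqrt{\frac Kn}\right)\right\}\frac{\kappa(s_*,4)}{\sqrt{s_*}}\ \xi_n .$$ Here $a\lesssim b$ means $a\le Cb$ for some positive constant $C$.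
   Context: Setting. $n,p,m,K$ are positive integers with $K<m$; $\mathbf X\in\mathbb{R}^{n\times p}$ is deterministic; $\mathbf Y=\mathbf XF^*+\boldsymbol\varepsilon$ with $F^*=\Psi^*+L^*$, $L^*=A^*B^*$, $\boldsymbol\varepsilon=\mathbf WB^*+\mathbf E$, where $\Psi^*\in\mathbb{R}^{p\times m}$, $A^*\in\mathbb{R}^{p\times K}$, $B^*\in\mathbb{R}^{K\times m}$ are deterministic, $\mathrm{rank}(B^* )=K$, and $\Psi^*$ has at most $s_*$ nonzero rows, $s_*\le p$. $\mathbf W\in\mathbb{R}^{n\times K}$ and $\mathbf E\in\mathbb{R}^{n\times m}$ are independent mean-zero random matrices, each with i.i.d. rows; $\Sigma_W=\mathrm{Cov}(\mathbf W_{i\cdot})$ has rank $K$, and $\mathrm{Cov}(\mathbf E_{i\cdot})=\tau^2I_m$. Noise assumption: for positive constants $\gamma_w,\gamma_e$: the vectors $\Sigma_W^{-1/2}\mathbf W_{i\cdot}$, $1\le i\le n$, are i.i.d. $\gamma_w$ sub-Gaussian; for each fixed $j$ the $\mathbf E_{ij}$, $1\le i\le n$, are i.i.d. $\gamma_e$ sub-Gaussian, and for each fixed $i$ the $\mathbf E_{ij}$, $1\le j\le m$, are independent. (A centered random variable $\xi$ is $\gamma$ sub-Gaussian if $\mathbb{E}e^{t\xi}\le e^{\gamma^2t^2/2}$ for all $t\in\mathbb{R}$; a random vector is $\gamma$ sub-Gaussian if its inner product with every unit vector is $\gamma$ sub-Gaussian.) Notation. $P_{B^*}=B^{*T}(B^*B^{*T})^{-1}B^*$,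 $P_{B^*}^\perp=I_m-P_{B^*}$, $\Theta^*=\Psi^*P_{B^*}^\perp$. $\|M\|_{\ell_1/\ell_2}=\sum_j\|M_{j\cdot}\|_2$ (sum over rows); $\|\cdot\|_{op}$, $\|\cdot\|_F$ are the operator and Frobenius norms. $\widehat\Sigma=n^{-1}\mathbf X^T\mathbf X$. $\Lambda_1$ is the largest eigenvalue of $B^{*T}\Sigma_WB^*$. Restricted eigenvalue: for an integer $1\le s\le p$ and a constant $\alpha\ge1$, $$\kappa(s,\alpha)=\min_{S\subseteq\{1,\dots,p\},|S|\le s}\ \min_{\Delta\in\mathcal C(S,\alpha)}\frac{\|\mathbf X\Delta\|_F}{\sqrt n\|\Delta_{S\cdot}\|_F},\quad \mathcal C(S,\alpha)=\{\Delta\in\mathbb{R}^{p\times m}\setminus\{0\}:\alpha\|\Delta_{S\cdot}\|_{\ell_1/\ell_2}\ge\|\Delta_{S^c\cdot}\|_{\ell_1/\ell_2}\}.$$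
   Formalization: The undefined "proper sequence" is made precise: either ξ_n is at most a positive constant ξ_0 (depending only on the noise constants and the constant in the event) with any estimator, or the estimator of P_{B*} is itself an orthogonal projection; for unrestricted ξ_n the claim fails. *)

theory Defs
  imports
    "HOL-Probability.Probability"
    "Jordan_Normal_Form.Matrix"
    "Jordan_Normal_Form.Gauss_Jordan_Elimination"
    "Jordan_Normal_Form.DL_Rank"
    "Jordan_Normal_Form.Char_Poly"
begin

text \<open>
  Dimensions are natural numbers, so that constants can be chosen uniformly in them.  Matrices are
  those of \<open>Jordan_Normal_Form.Matrix\<close>; rows and columns are numbered from 0.
\<close>

definition vec_norm2 :: "real vec \<Rightarrow> real" where
  "vec_norm2 v = sqrt (scalar_prod v v)"

definition frob_norm :: "real mat \<Rightarrow> real" where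
  "frob_norm A = sqrt (\<Sum>i<dim_row A. \<Sum>j<dim_col A. (A $$ (i, j))\<^sup>2)"

definition op_norm :: "real mat \<Rightarrow> real" where
  "op_norm A = (SUP v\<in>{v \<in> carrier_vec (dim_col A). vec_norm2 v \<le> 1}. vec_norm2 (A *\<^sub>v v))"

definition l1l2_norm :: "real mat \<Rightarrow> real" where
  "l1l2_norm A = (\<Sum>j<dim_row A. vec_norm2 (Matrix.row A j))"

text \<open>Rows outside \<open>S\<close> are set to zero instead of being deleted; this leaves
  \<open>frob_norm\<close> and \<open>l1l2_norm\<close> unchanged.\<close>

definition restrict_rows :: "nat set \<Rightarrow> real mat \<Rightarrow> real mat" where
  "restrict_rows S D =
     Matrix.mat (dim_row D) (dim_col D) (\<lambda>(j, k). if j \<in> S then D $$ (j, k) else 0)"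

definition largest_eigenvalue :: "real mat \<Rightarrow> real" where
  "largest_eigenvalue A = Max {x. eigenvalue A x}"

definition row_space_proj :: "real mat \<Rightarrow> real mat" where
  "row_space_proj B = transpose_mat B * the (mat_inverse (B * transpose_mat B)) * B"

definition orth_projection :: "nat \<Rightarrow> real mat \<Rightarrow> bool" where
  "orth_projection m P \<longleftrightarrow> P \<in> carrier_mat m m \<and> transpose_mat P = P \<and> P * P = P"

text \<open>
  \<open>R\<close> is the symmetric positive semidefinite square root of the inverse of \<open>S\<close>; for symmetric
  positive definite \<open>S\<close> there is exactly one such \<open>R\<close>.
\<close>

definition is_inv_sqrt :: "nat \<Rightarrow> real mat \<Rightarrow> real mat \<Rightarrow> bool" where
  "is_inv_sqrt k S R \<longleftrightarrow>
     R \<in> carrier_mat k k \<and> transpose_mat R = R \<and>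
     (\<forall>v\<in>carrier_vec k. 0 \<le> scalar_prod v (R *\<^sub>v v)) \<and>
     S * (R * R) = 1\<^sub>m k"

definition re_cone :: "nat \<Rightarrow> nat \<Rightarrow> nat set \<Rightarrow> real \<Rightarrow> real mat set" where
  "re_cone p m S \<alpha> =
     {D \<in> carrier_mat p m. D \<noteq> 0\<^sub>m p m \<and>
        l1l2_norm (restrict_rows ({..<p} - S) D) \<le> \<alpha> * l1l2_norm (restrict_rows S D)}"

text \<open>
  The cone is empty for empty \<open>S\<close>, so such \<open>S\<close> do not contribute to the infimum (their inner minimum
  is infinite).  Elements of the cone have a nonzero \<open>S\<close>-part, so no division by zero occurs, and
  for \<open>1 \<le> s\<close>, \<open>1 \<le> p\<close> and \<open>1 \<le> m\<close> the infimum is over a nonempty set and is attained.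
\<close>

definition restricted_eig :: "nat \<Rightarrow> nat \<Rightarrow> nat \<Rightarrow> real mat \<Rightarrow> nat \<Rightarrow> real \<Rightarrow> real" where
  "restricted_eig n p m X s \<alpha> =
     Inf {frob_norm (X * D) / (sqrt (real n) * frob_norm (restrict_rows S D)) | S D.
            S \<subseteq> {..<p} \<and> card S \<le> s \<and> D \<in> re_cone p m S \<alpha>}"

definition random_matrix :: "'w measure \<Rightarrow> nat \<Rightarrow> nat \<Rightarrow> ('w \<Rightarrow> real mat) \<Rightarrow> bool" where
  "random_matrix M r c Z \<longleftrightarrow>
     (\<forall>\<omega>\<in>space M. Z \<omega> \<in> carrier_mat r c) \<and>
     (\<forall>i<r. \<forall>j<c. (\<lambda>\<omega>. Z \<omega> $$ (i, j)) \<in> borel_measurable M)"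

text \<open>Matrices and rows as elements of a finite product space, as needed for joint laws.\<close>

definition matrix_entries :: "nat \<Rightarrow> nat \<Rightarrow> ('w \<Rightarrow> real mat) \<Rightarrow> 'w \<Rightarrow> nat \<times> nat \<Rightarrow> real" where
  "matrix_entries r c Z \<omega> = (\<lambda>ij\<in>{..<r} \<times> {..<c}. Z \<omega> $$ ij)"

definition row_entries :: "nat \<Rightarrow> ('w \<Rightarrow> real mat) \<Rightarrow> nat \<Rightarrow> 'w \<Rightarrow> nat \<Rightarrow> real" where
  "row_entries c Z i \<omega> = (\<lambda>j\<in>{..<c}. Z \<omega> $$ (i, j))"

context prob_space
begin

definition iid :: "'b measure \<Rightarrow> ('i \<Rightarrow> 'a \<Rightarrow> 'b) \<Rightarrow> 'i set \<Rightarrow> bool" where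
  "iid N Z I \<longleftrightarrow>
     indep_vars (\<lambda>_. N) Z I \<and> (\<forall>i\<in>I. \<forall>j\<in>I. distr M N (Z i) = distr M N (Z j))"

text \<open>
  Integrability of the exponentials is required explicitly because the expectation of a
  non-integrable function is 0 by convention.
\<close>

definition subgaussian :: "real \<Rightarrow> ('a \<Rightarrow> real) \<Rightarrow> bool" where
  "subgaussian \<gamma> Z \<longleftrightarrow>
     integrable M Z \<and> expectation Z = 0 \<and>
     (\<forall>t. integrable M (\<lambda>\<omega>. exp (t * Z \<omega>)) \<and>
          expectation (\<lambda>\<omega>. exp (t * Z \<omega>)) \<le> exp (\<gamma>\<^sup>2 * t\<^sup>2 / 2))"

definition subgaussian_vec :: "nat \<Rightarrow> real \<Rightarrow> ('a \<Rightarrow> real vec) \<Rightarrow> bool" where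
  "subgaussian_vec k \<gamma> Z \<longleftrightarrow>
     (\<forall>u\<in>carrier_vec k. vec_norm2 u = 1 \<longrightarrow> subgaussian \<gamma> (\<lambda>\<omega>. scalar_prod u (Z \<omega>)))"

definition row_cov :: "nat \<Rightarrow> ('a \<Rightarrow> real mat) \<Rightarrow> nat \<Rightarrow> real mat" where
  "row_cov c Z i = Matrix.mat c c (\<lambda>(a, b).
     expectation (\<lambda>\<omega>. (Z \<omega> $$ (i, a) - expectation (\<lambda>\<omega>. Z \<omega> $$ (i, a))) *
                      (Z \<omega> $$ (i, b) - expectation (\<lambda>\<omega>. Z \<omega> $$ (i, b)))))"

end

locale hidden_variable_model = prob_space M
  for M :: "'w measure" +
  fixes n p m K s :: nat
    and X \<Psi> A B \<Sigma>W :: "real mat"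
    and W E :: "'w \<Rightarrow> real mat"
    and \<tau> \<gamma>w \<gamma>e :: real
  assumes dims: "0 < n" "0 < p" "0 < m" "0 < K" "K < m"
    and carriers: "X \<in> carrier_mat n p" "\<Psi> \<in> carrier_mat p m"
      "A \<in> carrier_mat p K" "B \<in> carrier_mat K m"
    and rank_B: "vec_space.rank K B = K"
    and sparsity: "1 \<le> s" "s \<le> p" "card {j. j < p \<and> Matrix.row \<Psi> j \<noteq> 0\<^sub>v m} \<le> s"
    and random: "random_matrix M n K W" "random_matrix M n m E"
    and W_E_indep: "indep_var
      (\<Pi>\<^sub>M ij\<in>{..<n} \<times> {..<K}. borel) (matrix_entries n K W)
      (\<Pi>\<^sub>M ij\<in>{..<n} \<times> {..<m}. borel) (matrix_entries n m E)"
    and W_mean: "\<And>i k. i < n \<Longrightarrow> k < K \<Longrightarrow>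
      integrable M (\<lambda>\<omega>. W \<omega> $$ (i, k)) \<and> expectation (\<lambda>\<omega>. W \<omega> $$ (i, k)) = 0"
    and E_mean: "\<And>i j. i < n \<Longrightarrow> j < m \<Longrightarrow>
      integrable M (\<lambda>\<omega>. E \<omega> $$ (i, j)) \<and> expectation (\<lambda>\<omega>. E \<omega> $$ (i, j)) = 0"
    and W_rows_iid: "iid (\<Pi>\<^sub>M k\<in>{..<K}. borel) (row_entries K W) {..<n}"
    and E_rows_iid: "iid (\<Pi>\<^sub>M j\<in>{..<m}. borel) (row_entries m E) {..<n}"
    and W_cov: "\<And>i. i < n \<Longrightarrow> row_cov K W i = \<Sigma>W"
    and \<Sigma>W_rank: "vec_space.rank K \<Sigma>W = K"
    and E_cov: "\<And>i. i < n \<Longrightarrow> row_cov m E i = \<tau>\<^sup>2 \<cdot>\<^sub>m 1\<^sub>m m"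
    and gammas: "0 < \<gamma>w" "0 < \<gamma>e"
    and W_subgaussian: "\<exists>R. is_inv_sqrt K \<Sigma>W R \<and>
      (\<forall>i<n. subgaussian_vec K \<gamma>w (\<lambda>\<omega>. R *\<^sub>v Matrix.row (W \<omega>) i))"
    and E_subgaussian: "\<And>i j. i < n \<Longrightarrow> j < m \<Longrightarrow> subgaussian \<gamma>e (\<lambda>\<omega>. E \<omega> $$ (i, j))"
    and E_entries_indep: "\<And>i. i < n \<Longrightarrow> indep_vars (\<lambda>_. borel) (\<lambda>j \<omega>. E \<omega> $$ (i, j)) {..<m}"

definition coef :: "real mat \<Rightarrow> real mat \<Rightarrow> real mat \<Rightarrow> real mat" where
  "coef \<Psi> A B = \<Psi> + A * B"

definition response :: "real mat \<Rightarrow> real mat \<Rightarrow> real mat \<Rightarrow> real mat \<Rightarrow> real mat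
    \<Rightarrow> real mat \<Rightarrow> real mat" where
  "response X \<Psi> A B W E = X * coef \<Psi> A B + (W * B + E)"

definition Theta_star :: "nat \<Rightarrow> real mat \<Rightarrow> real mat \<Rightarrow> real mat" where
  "Theta_star m \<Psi> B = \<Psi> * (1\<^sub>m m - row_space_proj B)"

definition is_group_lasso_solution ::
    "nat \<Rightarrow> nat \<Rightarrow> nat \<Rightarrow> real mat \<Rightarrow> real mat \<Rightarrow> real mat \<Rightarrow> real \<Rightarrow> real mat \<Rightarrow> bool" where
  "is_group_lasso_solution n p m X Y P lam \<Theta> \<longleftrightarrow>
     is_arg_min (\<lambda>T. (1 / real n) * (frob_norm (Y * (1\<^sub>m m - P) - X * T))\<^sup>2 + lam * l1l2_norm T)
       (\<lambda>T. T \<in> carrier_mat p m) \<Theta>"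

definition sample_cov :: "nat \<Rightarrow> real mat \<Rightarrow> real mat" where
  "sample_cov n X = (1 / real n) \<cdot>\<^sub>m (transpose_mat X * X)"

definition lambda_bar :: "nat \<Rightarrow> nat \<Rightarrow> nat \<Rightarrow> real mat \<Rightarrow> real \<Rightarrow> real \<Rightarrow> real" where
  "lambda_bar n p m X \<gamma>e \<epsilon> =
     4 * \<gamma>e * sqrt (Max ((\<lambda>j. sample_cov n X $$ (j, j)) ` {..<p})) *
     ((sqrt (real m) + sqrt (2 * ln (real p / \<epsilon>))) / sqrt (real n))"

definition lambda_tilde :: "nat \<Rightarrow> nat \<Rightarrow> nat \<Rightarrow> nat \<Rightarrow> nat \<Rightarrow> real mat \<Rightarrow> real mat \<Rightarrow> real mat
    \<Rightarrow> real mat \<Rightarrow> real mat \<Rightarrow> real \<Rightarrow> real" where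
  "lambda_tilde n p m K s X \<Psi> A B \<Sigma>W \<xi> =
     ((1 / sqrt (real n)) * op_norm (X * coef \<Psi> A B) +
      sqrt (largest_eigenvalue (transpose_mat B * \<Sigma>W * B)) * (1 + sqrt (real K / real n))) *
     (restricted_eig n p m X s 4 / sqrt (real s)) * \<xi>"

end

theory Submission
  imports Defs
begin

text \<open>
  Let \<open>P\<close> be the row space projection of \<open>B\<close>, \<open>Q\<close> its estimator and \<open>F = \<Psi> + A B\<close>.  As \<open>B P = B\<close>, the
  residual at the target is \<open>(X F + W B) (P - Q) + E (I - Q)\<close>.  The first summand is a bias, small in
  Frobenius norm once the operator norm of the whitened \<open>W\<close> is controlled.  The penalty absorbs the
  second one once every \<open>E\<^sup>T X\<^sub>j\<close> is controlled, because \<open>I - Q\<close> is nearly nonexpansive.  The basic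
  inequality of the group lasso then leaves two cases: in the cone the restricted eigenvalue bounds
  the error, and outside it the penalty is dominated by the squared bias, which produces the term
  with the squared rate divided by \<open>lam\<close>.  Both random quantities are Euclidean norms of sub-Gaussian
  vectors, bounded by decoupling with independent Gaussians, plus a union bound over a lattice net
  of the unit ball for \<open>W\<close>.
\<close>

text \<open>The estimator may depend on the noise in an arbitrary way, so no probability bound may
  involve it. The exceptional event is therefore built from \<open>W\<close> and \<open>E\<close>
  alone, through bounds that hold for all directions or for all columns of \<open>X\<close>, and
  everything about \<open>Q\<close> is deterministic off that event. The factor 4 in
  \<open>lambda_bar\<close> makes the noise cross term at most half of the penalty, up to a relative
  excess \<eta> caused by \<open>I - Q\<close>. Without excess the basic inequality leads to a cone
  of constant 3; with \<eta> at most 1/8 the constant is 25/7, still below the 4 of the restricted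
  eigenvalue, and this gap is what makes the inequality coercive outside the cone. Hence the
  threshold \<open>1 / (8 * C\<^sub>0)\<close> for \<xi>. If \<open>Q\<close> is an orthogonal
  projection, \<open>I - Q\<close> is exactly nonexpansive and no threshold is imposed. For
  \<open>W\<close>, the net has at most \<open>exp (6 * K)\<close> points and each of them fails
  with probability at most \<open>exp (- 7 * K)\<close>.\<close>

unbundle no vec_syntax
unbundle no inner_syntax

section \<open>Euclidean, Frobenius and operator norms\<close>

lemma vec_norm2_eq_L2_set: "vec_norm2 v = L2_set (\<lambda>i. v $ i) {..<dim_vec v}"
  by (simp add: vec_norm2_def L2_set_def scalar_prod_def power2_eq_square atLeast0LessThan)

lemma vec_norm2_nonneg [simp]: "0 \<le> vec_norm2 v"
  by (simp add: vec_norm2_eq_L2_set L2_set_nonneg)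

lemma vec_norm2_power2: "(vec_norm2 v)\<^sup>2 = v \<bullet> v"
  by (simp add: vec_norm2_def scalar_prod_def sum_nonneg)

lemma vec_norm2_power2_sum: "v \<in> carrier_vec k \<Longrightarrow> (vec_norm2 v)\<^sup>2 = (\<Sum>i<k. (v $ i)\<^sup>2)"
  by (simp add: vec_norm2_eq_L2_set L2_set_def sum_nonneg carrier_vecD)

lemma vec_norm2_eq_0_iff:
  assumes "v \<in> carrier_vec k"
  shows "vec_norm2 v = 0 \<longleftrightarrow> v = 0\<^sub>v k"
  using assms by (auto simp: vec_norm2_eq_L2_set L2_set_eq_0_iff)

lemma vec_norm2_pos: "v \<in> carrier_vec k \<Longrightarrow> v \<noteq> 0\<^sub>v k \<Longrightarrow> 0 < vec_norm2 v"
  using vec_norm2_eq_0_iff[of v k] vec_norm2_nonneg[of v] by linarith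

lemma vec_norm2_zero [simp]: "vec_norm2 (0\<^sub>v k) = 0"
  by (simp add: vec_norm2_eq_0_iff[of _ k])

lemma vec_norm2_smult: "vec_norm2 (a \<cdot>\<^sub>v v) = \<bar>a\<bar> * vec_norm2 v"
  by (simp add: vec_norm2_def real_sqrt_mult power2_eq_square[symmetric] mult.assoc[symmetric])

lemma vec_norm2_triangle:
  assumes "v \<in> carrier_vec k" "w \<in> carrier_vec k"
  shows "vec_norm2 (v + w) \<le> vec_norm2 v + vec_norm2 w"
proof -
  have "L2_set (\<lambda>i. (v + w) $ i) {..<k} = L2_set (\<lambda>i. v $ i + w $ i) {..<k}"
    using assms by (intro L2_set_cong) auto
  with assms show ?thesis
    using L2_set_triangle_ineq[of "\<lambda>i. v $ i" "\<lambda>i. w $ i" "{..<k}"]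
    by (simp add: vec_norm2_eq_L2_set)
qed

lemma vec_norm2_minus_commute:
  assumes "v \<in> carrier_vec k" "w \<in> carrier_vec k"
  shows "vec_norm2 (v - w) = vec_norm2 (w - v)"
proof -
  have "w - v = (-1) \<cdot>\<^sub>v (v - w)" using assms by auto
  then show ?thesis by (simp add: vec_norm2_smult)
qed

lemma scalar_prod_le_vec_norm2:
  assumes "v \<in> carrier_vec k" "w \<in> carrier_vec k"
  shows "\<bar>v \<bullet> w\<bar> \<le> vec_norm2 v * vec_norm2 w"
proof -
  have "\<bar>v \<bullet> w\<bar> \<le> (\<Sum>i<k. \<bar>v $ i\<bar> * \<bar>w $ i\<bar>)"
    using assms by (simp add: scalar_prod_def atLeast0LessThan)
      (metis (mono_tags, lifting) abs_mult sum.cong sum_abs)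
  also have "\<dots> \<le> vec_norm2 v * vec_norm2 w"
    using assms by (simp add: vec_norm2_eq_L2_set L2_set_mult_ineq)
  finally show ?thesis .
qed

lemma frob_norm_nonneg [simp]: "0 \<le> frob_norm A"
  by (simp add: frob_norm_def sum_nonneg)

lemma frob_norm_power2:
  "A \<in> carrier_mat r c \<Longrightarrow> (frob_norm A)\<^sup>2 = (\<Sum>i<r. \<Sum>j<c. (A $$ (i, j))\<^sup>2)"
  by (auto simp: frob_norm_def sum_nonneg)

lemma frob_norm_power2_rows:
  assumes "A \<in> carrier_mat r c"
  shows "(frob_norm A)\<^sup>2 = (\<Sum>i<r. (vec_norm2 (row A i))\<^sup>2)"
  using assms by (auto simp: frob_norm_power2[OF assms] vec_norm2_power2_sum[of _ c] intro!: sum.cong)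

lemma frob_norm_power2_cols:
  assumes "A \<in> carrier_mat r c"
  shows "(frob_norm A)\<^sup>2 = (\<Sum>j<c. (vec_norm2 (col A j))\<^sup>2)"
proof -
  have "(frob_norm A)\<^sup>2 = (\<Sum>j<c. \<Sum>i<r. (A $$ (i, j))\<^sup>2)"
    unfolding frob_norm_power2[OF assms] by (rule sum.swap)
  then show ?thesis
    using assms by (auto simp: vec_norm2_power2_sum[of _ r] intro!: sum.cong)
qed

lemma frob_norm_transpose [simp]: "frob_norm (transpose_mat A) = frob_norm A"
proof -
  have "(frob_norm (transpose_mat A))\<^sup>2 = (frob_norm A)\<^sup>2"
    using frob_norm_power2_rows[of "transpose_mat A" "dim_col A" "dim_row A"]
      frob_norm_power2_cols[of A "dim_row A" "dim_col A"] by simp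
  then show ?thesis by simp
qed

lemma vec_norm2_mult_mat_vec_le_frob:
  assumes A: "A \<in> carrier_mat r c" and v: "v \<in> carrier_vec c"
  shows "vec_norm2 (A *\<^sub>v v) \<le> frob_norm A * vec_norm2 v"
proof -
  have "(vec_norm2 (A *\<^sub>v v))\<^sup>2 = (\<Sum>i<r. (row A i \<bullet> v)\<^sup>2)"
    using A by (subst vec_norm2_power2_sum[of _ r]) (simp_all add: mult_mat_vec_carrier[OF A v])
  also have "\<dots> \<le> (\<Sum>i<r. (vec_norm2 (row A i) * vec_norm2 v)\<^sup>2)"
  proof (intro sum_mono)
    fix i assume "i \<in> {..<r}"
    then have "\<bar>row A i \<bullet> v\<bar> \<le> vec_norm2 (row A i) * vec_norm2 v"
      using A v by (intro scalar_prod_le_vec_norm2[of _ c]) auto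
    then show "(row A i \<bullet> v)\<^sup>2 \<le> (vec_norm2 (row A i) * vec_norm2 v)\<^sup>2"
      by (metis abs_ge_zero power2_abs power_mono)
  qed
  also have "\<dots> = (frob_norm A * vec_norm2 v)\<^sup>2"
    by (simp add: frob_norm_power2_rows[OF A] power_mult_distrib sum_distrib_right)
  finally show ?thesis by (rule power2_le_imp_le) simp
qed

text \<open>The Frobenius norm dominates. Boundedness has to be secured because a real supremum
  carries no information on an unbounded set.\<close>

lemma bdd_above_op_norm:
  "bdd_above ((\<lambda>v. vec_norm2 (A *\<^sub>v v)) ` {v \<in> carrier_vec (dim_col A). vec_norm2 v \<le> 1})"
proof (rule bdd_aboveI2)
  fix v assume "v \<in> {v \<in> carrier_vec (dim_col A). vec_norm2 v \<le> 1}"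
  then have "vec_norm2 (A *\<^sub>v v) \<le> frob_norm A * vec_norm2 v" "vec_norm2 v \<le> 1"
    by (auto intro: vec_norm2_mult_mat_vec_le_frob)
  then show "vec_norm2 (A *\<^sub>v v) \<le> frob_norm A"
    by (smt (verit) frob_norm_nonneg mult_left_le)
qed

lemma vec_norm2_le_op_norm:
  assumes A: "A \<in> carrier_mat r c" and v: "v \<in> carrier_vec c"
  shows "vec_norm2 (A *\<^sub>v v) \<le> op_norm A * vec_norm2 v"
proof (cases "v = 0\<^sub>v c")
  case True
  then have "vec_norm2 v = 0" by simp
  with vec_norm2_mult_mat_vec_le_frob[OF A v] show ?thesis by simp
next
  case False
  then have pos: "vec_norm2 v > 0"
    using v vec_norm2_eq_0_iff[OF v] by (simp add: less_le)
  define u where "u = (1 / vec_norm2 v) \<cdot>\<^sub>v v"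
  have u: "u \<in> carrier_vec c" "vec_norm2 u = 1"
    using v pos by (simp_all add: u_def vec_norm2_smult)
  have "vec_norm2 (A *\<^sub>v u) \<le> op_norm A"
    unfolding op_norm_def
    using u A by (intro cSUP_upper bdd_above_op_norm) auto
  moreover have "A *\<^sub>v u = (1 / vec_norm2 v) \<cdot>\<^sub>v (A *\<^sub>v v)"
    using A v by (auto simp: u_def mult_mat_vec)
  ultimately show ?thesis using pos by (simp add: vec_norm2_smult field_simps)
qed

lemma op_norm_nonneg [simp]: "0 \<le> op_norm A"
proof -
  have "vec_norm2 (A *\<^sub>v 0\<^sub>v (dim_col A)) \<le> op_norm A"
    unfolding op_norm_def by (rule cSUP_upper[OF _ bdd_above_op_norm]) simp
  then show ?thesis using vec_norm2_nonneg order_trans by blast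
qed

text \<open>Column by column. The operator bound is an arbitrary \<open>C\<close> rather than
  \<open>op_norm A\<close>, because the design and the hidden signal are bounded separately and the
  two bounds are then added.\<close>

lemma frob_norm_mult_le:
  assumes A: "A \<in> carrier_mat r c" and D: "D \<in> carrier_mat c d" and "0 \<le> C"
    and le: "\<And>v. v \<in> carrier_vec c \<Longrightarrow> vec_norm2 (A *\<^sub>v v) \<le> C * vec_norm2 v"
  shows "frob_norm (A * D) \<le> C * frob_norm D"
proof -
  have "(frob_norm (A * D))\<^sup>2 = (\<Sum>j<d. (vec_norm2 (col (A * D) j))\<^sup>2)"
    using A D by (intro frob_norm_power2_cols[of _ r d]) simp
  also have "\<dots> = (\<Sum>j<d. (vec_norm2 (A *\<^sub>v col D j))\<^sup>2)"
    by (intro sum.cong refl) (simp only: lessThan_iff col_mult2[OF A D])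
  also have "\<dots> \<le> (\<Sum>j<d. (C * vec_norm2 (col D j))\<^sup>2)"
    using D by (intro sum_mono power_mono le) (simp_all add: carrier_vecI)
  also have "\<dots> = (C * frob_norm D)\<^sup>2"
    by (simp add: frob_norm_power2_cols[OF D] power_mult_distrib sum_distrib_left)
  finally show ?thesis by (rule power2_le_imp_le) (simp add: \<open>0 \<le> C\<close>)
qed

lemma l1l2_norm_nonneg [simp]: "0 \<le> l1l2_norm A"
  by (simp add: l1l2_norm_def sum_nonneg)

section \<open>Row space projections and the largest eigenvalue\<close>

lemma det_nonzero_mat_inverse:
  fixes A :: "'a :: field mat"
  assumes A: "A \<in> carrier_mat k k" and det: "det A \<noteq> 0"
  shows "the (mat_inverse A) \<in> carrier_mat k k"
    and "A * the (mat_inverse A) = 1\<^sub>m k" and "the (mat_inverse A) * A = 1\<^sub>m k"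
proof -
  have "mat_inverse A \<noteq> None"
    using mat_inverse(1)[OF A, of "()"] det_non_zero_imp_unit[OF A det, of "()"] by blast
  then obtain Q where "mat_inverse A = Some Q" by blast
  with mat_inverse(2)[OF A] show "the (mat_inverse A) \<in> carrier_mat k k"
    "A * the (mat_inverse A) = 1\<^sub>m k" "the (mat_inverse A) * A = 1\<^sub>m k" by auto
qed

text \<open>A kernel vector \<open>v\<close> of the Gram matrix satisfies |B^T v|^2 = v . B B^T v =
  0, so it is orthogonal to every column of \<open>B\<close>. Full rank makes the columns span,
  hence \<open>v\<close> is orthogonal to itself.\<close>

lemma gram_det_nonzero:
  fixes B :: "real mat"
  assumes B: "B \<in> carrier_mat k m" and rank: "vec_space.rank k B = k"
  shows "det (B * transpose_mat B) \<noteq> 0"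
proof
  interpret vec_space "TYPE(real)" k .
  assume "det (B * transpose_mat B) = 0"
  then obtain v where v: "v \<in> carrier_vec k" "v \<noteq> 0\<^sub>v k" "(B * transpose_mat B) *\<^sub>v v = 0\<^sub>v k"
    using det_0_iff_vec_prod_zero[of "B * transpose_mat B" k] B by auto
  define w where "w = transpose_mat B *\<^sub>v v"
  have w: "w \<in> carrier_vec m" using B v by (auto simp: w_def)
  have "w \<bullet> w = v \<bullet> (B *\<^sub>v w)"
    using transpose_vec_mult_scalar[OF B w v(1)] by (simp add: w_def)
  also have "B *\<^sub>v w = 0\<^sub>v k"
    using v(3) B v(1) by (simp add: w_def assoc_mult_mat_vec[of _ k m _ k])
  finally have "(vec_norm2 w)\<^sup>2 = 0" using v by (simp add: vec_norm2_power2)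
  then have w0: "w = 0\<^sub>v m" using vec_norm2_eq_0_iff[OF w] by simp
  have cols: "set (cols B) \<subseteq> carrier_vec k" using B cols_dim by blast
  have "v \<bullet> y = 0" if y: "y \<in> set (cols B)" for y
  proof -
    obtain j where j: "j < m" "y = col B j" using y B by (auto simp: cols_def)
    then have "w $ j = y \<bullet> v" using B v by (simp add: w_def)
    then show ?thesis using w0 j B v by (simp add: comm_scalar_prod[of _ k])
  qed
  then have "v \<in> orthogonal_complement (set (cols B))"
    using v by (auto simp: orthogonal_complement_def)
  then have "v \<in> orthogonal_complement (span (set (cols B)))"
    using cols by simp
  moreover have "span (set (cols B)) = carrier_vec k"
  proof -
    \<comment> \<open>A maximal independent set of columns has as many elements as the rank, here
      the full dimension, so it is a basis.\<close>
    obtain S where S: "finite S" "maximal S (\<lambda>T. T \<subseteq> set (cols B) \<and> lin_indpt T)"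
      using maximal_exists_superset[of "set (cols B)" "\<lambda>T. T \<subseteq> set (cols B) \<and> lin_indpt T" "{}"]
      by (auto simp: lin_dep_def)
    have card: "card S = k" using rank_card_indpt[OF B S(2)] rank by simp
    have sub: "S \<subseteq> set (cols B)" "lin_indpt S" using S(2) by (auto simp: maximal_def)
    have "basis S"
      using sub cols card S(1) by (intro dim_li_is_basis) (auto simp: dim_is_n)
    then have "span S = carrier_vec k" by (simp add: basis_def)
    with sub show ?thesis using span_is_monotone[OF sub(1)] span_closed[OF cols] by auto
  qed
  ultimately have "v \<bullet> v = 0" using v by (auto simp: orthogonal_complement_def)
  then have "(vec_norm2 v)\<^sup>2 = 0" by (simp add: vec_norm2_power2)
  with v vec_norm2_eq_0_iff[OF v(1)] show False by simp
qed

lemma row_space_proj: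
  assumes B: "B \<in> carrier_mat k m" and rank: "vec_space.rank k B = k"
  shows "row_space_proj B \<in> carrier_mat m m"
    and "transpose_mat (row_space_proj B) = row_space_proj B"
    and "row_space_proj B * row_space_proj B = row_space_proj B"
    and "B * row_space_proj B = B"
proof -
  define H where "H = B * transpose_mat B"
  define Q where "Q = the (mat_inverse H)"
  have BT: "transpose_mat B \<in> carrier_mat m k" using B by simp
  have H: "H \<in> carrier_mat k k" "det H \<noteq> 0" "transpose_mat H = H"
    using B gram_det_nonzero[OF B rank] by (auto simp: H_def transpose_mult[OF B BT])
  have Q: "Q \<in> carrier_mat k k" "H * Q = 1\<^sub>m k" "Q * H = 1\<^sub>m k"
    using det_nonzero_mat_inverse[OF H(1,2)] by (auto simp: Q_def)
  have QT: "transpose_mat Q = Q"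
  proof -
    have "transpose_mat Q = transpose_mat Q * (H * Q)" using Q by simp
    also have "\<dots> = transpose_mat Q * transpose_mat H * Q"
      using Q H by (simp add: assoc_mult_mat[of _ k k _ k _ k])
    also have "transpose_mat Q * transpose_mat H = 1\<^sub>m k"
      using transpose_mult[OF H(1) Q(1)] Q by simp
    finally show ?thesis using Q by simp
  qed
  have P: "row_space_proj B = transpose_mat B * Q * B"
    by (simp add: row_space_proj_def Q_def H_def)
  have BTQ: "transpose_mat B * Q \<in> carrier_mat m k" using BT Q by simp
  show car: "row_space_proj B \<in> carrier_mat m m" using P BTQ B by simp
  show "transpose_mat (row_space_proj B) = row_space_proj B"
    unfolding P transpose_mult[OF BTQ B] transpose_mult[OF BT Q(1)] QT
    using B BT Q by (simp add: assoc_mult_mat[of _ m k _ k _ m])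
  have "B * row_space_proj B = (B * (transpose_mat B * Q)) * B"
    unfolding P using assoc_mult_mat[OF B BTQ B] by simp
  also have "B * (transpose_mat B * Q) = H * Q"
    unfolding H_def using assoc_mult_mat[OF B BT Q(1)] by simp
  finally show BP: "B * row_space_proj B = B" using Q B by simp
  have "row_space_proj B * row_space_proj B = transpose_mat B * Q * (B * row_space_proj B)"
    using assoc_mult_mat[OF BTQ B car] P by simp
  then show "row_space_proj B * row_space_proj B = row_space_proj B"
    using BP P by simp
qed

text \<open>Pythagoras: |v - P v|^2 = |v|^2 - |P v|^2, since symmetry and idempotence give P v . P v
  = v . P v.\<close>

lemma vec_norm2_projection_complement_le:
  assumes P: "P \<in> carrier_mat m m" "transpose_mat P = P" "P * P = P" and v: "v \<in> carrier_vec m"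
  shows "vec_norm2 ((1\<^sub>m m - P) *\<^sub>v v) \<le> vec_norm2 v"
proof -
  let ?w = "(1\<^sub>m m - P) *\<^sub>v v"
  have Pv: "P *\<^sub>v v \<in> carrier_vec m" using P v by simp
  have w: "?w = v - P *\<^sub>v v" using P v by (simp add: minus_mult_distrib_mat_vec[of _ m m])
  have "(P *\<^sub>v v) \<bullet> (P *\<^sub>v v) = v \<bullet> (P *\<^sub>v v)"
  proof -
    have "(P *\<^sub>v v) \<bullet> (P *\<^sub>v v) = v \<bullet> (P *\<^sub>v (P *\<^sub>v v))"
      using transpose_vec_mult_scalar[OF P(1) Pv v] P(2) by simp
    also have "P *\<^sub>v (P *\<^sub>v v) = P *\<^sub>v v"
      using assoc_mult_mat_vec[OF P(1) P(1) v] P(3) by simp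
    finally show ?thesis .
  qed
  then have "?w \<bullet> ?w = v \<bullet> v - (P *\<^sub>v v) \<bullet> (P *\<^sub>v v)"
    unfolding w using v Pv
    by (simp add: minus_scalar_prod_distrib[of _ m] scalar_prod_minus_distrib[of _ m]
        comm_scalar_prod[of "P *\<^sub>v v" m v])
  then have "(vec_norm2 ?w)\<^sup>2 \<le> (vec_norm2 v)\<^sup>2"
    unfolding vec_norm2_power2[symmetric] by simp
  then show ?thesis by (rule power2_le_imp_le) simp
qed

text \<open>\<open>largest_eigenvalue\<close> is a maximum over the spectrum, whereas the supremum
  \<mu> of the form on the unit sphere is what bounds the form. That \<mu> is an eigenvalue is shown
  without compactness: \<mu> I - H is positive semidefinite, and were it invertible, its form would
  stay away from 0 on the sphere, against the choice of \<mu>.\<close>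

lemma quadratic_form_le_largest_eigenvalue:
  assumes H: "H \<in> carrier_mat m m" "transpose_mat H = H" and m: "0 < m"
    and v: "v \<in> carrier_vec m"
  shows "v \<bullet> (H *\<^sub>v v) \<le> largest_eigenvalue H * (vec_norm2 v)\<^sup>2"
proof -
  define U where "U = {v \<in> carrier_vec m. vec_norm2 v = 1}"
  define q where "q v = v \<bullet> (H *\<^sub>v v)" for v
  define \<mu> where "\<mu> = Sup (q ` U)"
  have q_le: "q v \<le> frob_norm H * (vec_norm2 v)\<^sup>2" if v: "v \<in> carrier_vec m" for v
  proof -
    have "q v \<le> vec_norm2 v * vec_norm2 (H *\<^sub>v v)"
      using scalar_prod_le_vec_norm2[of v m "H *\<^sub>v v"] H v by (auto simp: q_def)
    also have "\<dots> \<le> vec_norm2 v * (frob_norm H * vec_norm2 v)"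
      using H v by (intro mult_left_mono vec_norm2_mult_mat_vec_le_frob) auto
    finally show ?thesis by (simp add: power2_eq_square mult_ac)
  qed
  have bdd: "bdd_above (q ` U)"
    using q_le by (intro bdd_aboveI2[of _ _ "frob_norm H"]) (force simp: U_def)
  have "vec_norm2 (unit_vec m 0) = 1" using m by (simp add: vec_norm2_def)
  then have ne: "U \<noteq> {}" by (auto simp: U_def intro!: exI[of _ "unit_vec m 0"])
  have q_le_\<mu>: "q v \<le> \<mu> * (vec_norm2 v)\<^sup>2" if v: "v \<in> carrier_vec m" for v
  proof (cases "v = 0\<^sub>v m")
    case True
    then show ?thesis using q_le[OF v] by simp
  next
    case False
    then have pos: "vec_norm2 v > 0" using vec_norm2_eq_0_iff[OF v] by (simp add: less_le)
    define u where "u = (1 / vec_norm2 v) \<cdot>\<^sub>v v"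
    have u: "u \<in> U" using v pos by (simp add: u_def U_def vec_norm2_smult)
    have "q u \<le> \<mu>" unfolding \<mu>_def by (intro cSup_upper imageI u bdd)
    moreover have "q u = q v / (vec_norm2 v)\<^sup>2"
      using H v by (simp add: q_def u_def mult_mat_vec[of _ m m] power2_eq_square)
    ultimately show ?thesis using pos by (simp add: field_simps)
  qed
  define T where "T = \<mu> \<cdot>\<^sub>m 1\<^sub>m m - H"
  have T: "T \<in> carrier_mat m m" using H by (auto simp: T_def)
  have TT: "transpose_mat T = T"
  proof (rule eq_matI)
    fix i j assume "i < dim_row T" "j < dim_col T"
    moreover have "H $$ (j, i) = H $$ (i, j)" if "i < m" "j < m"
      using H that by (metis carrier_matD index_transpose_mat(1))
    ultimately show "transpose_mat T $$ (i, j) = T $$ (i, j)"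
      using H by (auto simp: T_def)
  qed (use T in auto)
  have Tv: "T *\<^sub>v v = \<mu> \<cdot>\<^sub>v v - H *\<^sub>v v" if "v \<in> carrier_vec m" for v
  proof -
    have "(\<mu> \<cdot>\<^sub>m 1\<^sub>m m) *\<^sub>v v = \<mu> \<cdot>\<^sub>v v" using that by (intro eq_vecI) auto
    then show ?thesis using H that by (simp add: T_def minus_mult_distrib_mat_vec[of _ m m])
  qed
  have form: "v \<bullet> (T *\<^sub>v v) = \<mu> * (vec_norm2 v)\<^sup>2 - q v" if "v \<in> carrier_vec m" for v
    using that H by (simp add: Tv q_def vec_norm2_power2 scalar_prod_minus_distrib[of _ m])
  have psd: "0 \<le> v \<bullet> (T *\<^sub>v v)" if "v \<in> carrier_vec m" for v
    using q_le_\<mu>[OF that] form[OF that] by simp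
  define L where "L = frob_norm T + 1"
  have L: "L > 0" "frob_norm T \<le> L" by (auto simp: L_def add_nonneg_pos)
  \<comment> \<open>The semidefinite form is nonnegative at v - T v / L; expanding it there, with
    \<open>L\<close> above the norm of \<open>T\<close>, gives the estimate.\<close>
  have Tv_le: "(vec_norm2 (T *\<^sub>v v))\<^sup>2 \<le> L * (v \<bullet> (T *\<^sub>v v))" if v: "v \<in> carrier_vec m" for v
  proof -
    define w where "w = T *\<^sub>v v"
    have w: "w \<in> carrier_vec m" using T v by (simp add: w_def)
    define t where "t = - (1 / L)"
    have Tw: "T *\<^sub>v w \<in> carrier_vec m" using T w by simp
    have cross: "v \<bullet> (T *\<^sub>v w) = w \<bullet> w"
      using transpose_vec_mult_scalar[OF T w v] TT by (simp add: w_def)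
    have "T *\<^sub>v (v + t \<cdot>\<^sub>v w) = w + t \<cdot>\<^sub>v (T *\<^sub>v w)"
      using T v w by (simp add: mult_add_distrib_mat_vec[of _ m m] mult_mat_vec[of _ m m] w_def)
    then have "(v + t \<cdot>\<^sub>v w) \<bullet> (T *\<^sub>v (v + t \<cdot>\<^sub>v w))
        = v \<bullet> w + 2 * t * (w \<bullet> w) + t\<^sup>2 * (w \<bullet> (T *\<^sub>v w))"
      using v w Tw cross
      by (simp add: add_scalar_prod_distrib[of _ m] scalar_prod_add_distrib[of _ m]
          power2_eq_square algebra_simps)
    then have "0 \<le> v \<bullet> w + 2 * t * (w \<bullet> w) + t\<^sup>2 * (w \<bullet> (T *\<^sub>v w))"
      using psd[of "v + t \<cdot>\<^sub>v w"] v w by simp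
    also have "w \<bullet> (T *\<^sub>v w) \<le> L * (w \<bullet> w)"
    proof -
      have "w \<bullet> (T *\<^sub>v w) \<le> vec_norm2 w * vec_norm2 (T *\<^sub>v w)"
        using scalar_prod_le_vec_norm2[OF w Tw] by simp
      also have "\<dots> \<le> vec_norm2 w * (L * vec_norm2 w)"
        using vec_norm2_mult_mat_vec_le_frob[OF T w] L
        by (intro mult_left_mono order_trans[OF _ mult_right_mono[OF L(2)]]) auto
      finally show ?thesis by (simp add: vec_norm2_power2[symmetric] power2_eq_square mult_ac)
    qed
    finally have "0 \<le> v \<bullet> w + 2 * t * (w \<bullet> w) + t\<^sup>2 * (L * (w \<bullet> w))"
      by (simp add: mult_left_mono)
    then have "0 \<le> v \<bullet> w - (w \<bullet> w) / L"
      using L by (simp add: t_def power2_eq_square)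
    then show ?thesis using L by (simp add: field_simps vec_norm2_power2 w_def)
  qed
  have "det T = 0"
  proof (rule ccontr)
    assume det: "det T \<noteq> 0"
    define Q where "Q = the (mat_inverse T)"
    have Q: "Q \<in> carrier_mat m m" "Q * T = 1\<^sub>m m"
      using det_nonzero_mat_inverse[OF T det] by (auto simp: Q_def)
    define L' where "L' = frob_norm Q + 1"
    have L': "L' > 0" "frob_norm Q \<le> L'" by (auto simp: L'_def add_nonneg_pos)
    \<comment> \<open>From 1 = |Q T v| \<le> L' |T v| and \<open>Tv_le\<close>, the form of
      \<open>T\<close> is at least this positive constant at every unit vector.\<close>
    have "q v \<le> \<mu> - 1 / (L'\<^sup>2 * L)" if "v \<in> U" for v
    proof -
      have v: "v \<in> carrier_vec m" "vec_norm2 v = 1" using that by (auto simp: U_def)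
      have "1 = vec_norm2 (Q *\<^sub>v (T *\<^sub>v v))"
        using v Q assoc_mult_mat_vec[OF Q(1) T v(1)] by simp
      also have "\<dots> \<le> frob_norm Q * vec_norm2 (T *\<^sub>v v)"
        using T v Q by (intro vec_norm2_mult_mat_vec_le_frob[of _ m m]) auto
      also have "\<dots> \<le> L' * vec_norm2 (T *\<^sub>v v)" using L' by (intro mult_right_mono) auto
      finally have "1\<^sup>2 \<le> (L' * vec_norm2 (T *\<^sub>v v))\<^sup>2" by (intro power_mono) auto
      also have "\<dots> \<le> L'\<^sup>2 * (L * (v \<bullet> (T *\<^sub>v v)))"
        unfolding power_mult_distrib using Tv_le[OF v(1)] by (intro mult_left_mono) auto
      finally have "1 \<le> L'\<^sup>2 * L * (\<mu> - q v)" using form[OF v(1)] v by (simp add: mult_ac)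
      then show ?thesis using L L' by (simp add: field_simps)
    qed
    then have "\<mu> \<le> \<mu> - 1 / (L'\<^sup>2 * L)"
      unfolding \<mu>_def by (intro cSup_least) (use ne in auto)
    moreover have "1 / (L'\<^sup>2 * L) > 0" using L L' by simp
    ultimately show False by linarith
  qed
  then obtain w where w: "w \<in> carrier_vec m" "w \<noteq> 0\<^sub>v m" "T *\<^sub>v w = 0\<^sub>v m"
    using det_0_iff_vec_prod_zero[OF T] by blast
  have "H *\<^sub>v w = \<mu> \<cdot>\<^sub>v w"
  proof (rule eq_vecI)
    fix i assume "i < dim_vec (\<mu> \<cdot>\<^sub>v w)"
    then have i: "i < m" using w by simp
    have "(\<mu> \<cdot>\<^sub>v w - H *\<^sub>v w) $ i = 0" using w Tv[OF w(1)] i by simp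
    then show "(H *\<^sub>v w) $ i = (\<mu> \<cdot>\<^sub>v w) $ i"
      using i w H by simp
  qed (use H w in auto)
  then have "eigenvalue H \<mu>" using w H by (auto simp: eigenvalue_def eigenvector_def)
  \<comment> \<open>\<open>Max\<close> is an upper bound only on a finite set; the eigenvalues are
    the roots of a nonzero polynomial.\<close>
  moreover have "finite {x. eigenvalue H x}"
  proof -
    have "char_poly H \<noteq> 0" using degree_monic_char_poly[OF H(1)] m by auto
    then show ?thesis using poly_roots_finite eigenvalue_root_char_poly[OF H(1)] by simp
  qed
  ultimately have "\<mu> \<le> largest_eigenvalue H" by (simp add: largest_eigenvalue_def)
  then show ?thesis
    using q_le_\<mu>[OF v] mult_right_mono[of \<mu> "largest_eigenvalue H" "(vec_norm2 v)\<^sup>2"]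
    by (simp add: q_def)
qed

section \<open>Norms of sub-Gaussian vectors\<close>

lemma nn_integral_normal_density: "0 < \<sigma> \<Longrightarrow> (\<integral>\<^sup>+x. ennreal (normal_density \<mu> \<sigma> x) \<partial>lborel) = 1"
  by (subst nn_integral_eq_integral) auto

text \<open>Completing the square turns the tilted density into a shifted one. The nonnegative
  integral avoids integrability conditions when integrals are exchanged later.\<close>

lemma nn_integral_std_normal_exp:
  "(\<integral>\<^sup>+g. ennreal (exp (s * g)) \<partial>density lborel std_normal_density) = ennreal (exp (s\<^sup>2 / 2))"
proof -
  have eq: "std_normal_density g * exp (s * g) = exp (s\<^sup>2 / 2) * normal_density s 1 g" for g
  proof -
    have "- g\<^sup>2 / 2 + s * g = s\<^sup>2 / 2 + - (g - s)\<^sup>2 / 2"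
      by (simp add: power2_eq_square field_simps)
    then have "exp (- g\<^sup>2 / 2) * exp (s * g) = exp (s\<^sup>2 / 2) * exp (- (g - s)\<^sup>2 / 2)"
      by (simp only: exp_add[symmetric])
    then show ?thesis by (simp add: normal_density_def)
  qed
  have "(\<integral>\<^sup>+g. ennreal (exp (s * g)) \<partial>density lborel std_normal_density)
      = (\<integral>\<^sup>+g. ennreal (exp (s\<^sup>2 / 2)) * ennreal (normal_density s 1 g) \<partial>lborel)"
    by (subst nn_integral_density) (auto simp: ennreal_mult[symmetric] eq)
  also have "\<dots> = ennreal (exp (s\<^sup>2 / 2))"
    by (subst nn_integral_cmult) (auto simp: nn_integral_normal_density)
  finally show ?thesis .
qed

text \<open>The tilted density is a multiple of the centred normal density with variance 1 / (1 -
  b), and the multiple is its standard deviation.\<close>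

lemma nn_integral_std_normal_exp_square:
  assumes "b < 1"
  shows "(\<integral>\<^sup>+g. ennreal (exp (b * g\<^sup>2 / 2)) \<partial>density lborel std_normal_density)
    = ennreal (1 / sqrt (1 - b))"
proof -
  define \<sigma> where "\<sigma> = 1 / sqrt (1 - b)"
  have \<sigma>: "0 < \<sigma>" "\<sigma>\<^sup>2 = 1 / (1 - b)" using assms by (auto simp: \<sigma>_def power_divide)
  have eq: "std_normal_density g * exp (b * g\<^sup>2 / 2) = \<sigma> * normal_density 0 \<sigma> g" for g
  proof -
    have "sqrt (2 * pi * \<sigma>\<^sup>2) = sqrt (2 * pi) * \<sigma>"
      using \<sigma>(1) real_sqrt_mult[of "2 * pi" "\<sigma>\<^sup>2"] by (simp only: real_sqrt_abs abs_of_pos)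
    moreover have "- g\<^sup>2 / (2 * \<sigma>\<^sup>2) = - g\<^sup>2 / 2 + b * g\<^sup>2 / 2"
      using assms by (simp add: \<sigma>(2) field_simps)
    moreover have "exp (- g\<^sup>2 / 2 + b * g\<^sup>2 / 2) = exp (- g\<^sup>2 / 2) * exp (b * g\<^sup>2 / 2)"
      by (rule exp_add)
    ultimately show ?thesis
      using \<sigma>(1) by (simp add: normal_density_def)
  qed
  have "(\<integral>\<^sup>+g. ennreal (exp (b * g\<^sup>2 / 2)) \<partial>density lborel std_normal_density)
      = (\<integral>\<^sup>+g. ennreal \<sigma> * ennreal (normal_density 0 \<sigma> g) \<partial>lborel)"
    using \<sigma> by (subst nn_integral_density) (auto simp: ennreal_mult[symmetric] eq)
  also have "\<dots> = ennreal \<sigma>"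
    using \<sigma> by (subst nn_integral_cmult) (auto simp: nn_integral_normal_density)
  finally show ?thesis by (simp add: \<sigma>_def)
qed

context prob_space
begin

text \<open>Gaussian decoupling: \<open>exp (\<kappa> x\<^sup>2)\<close> is the mean of \<open>exp (sqrt (2 * \<kappa>) * x * g)\<close> over a
  standard normal \<open>g\<close>, which reduces squares to the exponential moments of linear forms.\<close>

lemma nn_integral_exp_sum_squares_le:
  fixes \<xi> :: "'k \<Rightarrow> 'a \<Rightarrow> real"
  assumes I: "finite I" and meas: "\<And>k. k \<in> I \<Longrightarrow> \<xi> k \<in> borel_measurable M"
    and mgf: "\<And>t. (\<integral>\<^sup>+\<omega>. ennreal (exp (\<Sum>k\<in>I. t k * \<xi> k \<omega>)) \<partial>M)
      \<le> ennreal (exp (\<gamma>\<^sup>2 * (\<Sum>k\<in>I. (t k)\<^sup>2) / 2))"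
    and \<kappa>: "0 \<le> \<kappa>" "2 * \<kappa> * \<gamma>\<^sup>2 < 1"
  shows "(\<integral>\<^sup>+\<omega>. ennreal (exp (\<kappa> * (\<Sum>k\<in>I. (\<xi> k \<omega>)\<^sup>2))) \<partial>M)
    \<le> ennreal ((1 / sqrt (1 - 2 * \<kappa> * \<gamma>\<^sup>2)) ^ card I)"
proof -
  define N where "N = density lborel (\<lambda>x. ennreal (std_normal_density x))"
  interpret N: prob_space N unfolding N_def by (rule prob_space_normal_density) simp
  interpret PN: product_prob_space "\<lambda>_. N" I ..
  interpret PI: prob_space "Pi\<^sub>M I (\<lambda>_. N)" by (rule prob_space_PiM) (rule N.prob_space_axioms)
  interpret P2: pair_sigma_finite M "Pi\<^sub>M I (\<lambda>_. N)" ..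
  have setsN [measurable_cong, simp]: "sets N = sets borel" by (simp add: N_def)
  note meas [measurable]
  define a where "a = sqrt (2 * \<kappa>)"
  have a2: "a\<^sup>2 = 2 * \<kappa>" using \<kappa> by (simp add: a_def)
  have expand: "ennreal (exp (\<kappa> * (\<Sum>k\<in>I. (\<xi> k \<omega>)\<^sup>2)))
      = (\<integral>\<^sup>+g. ennreal (exp (\<Sum>k\<in>I. (a * g k) * \<xi> k \<omega>)) \<partial>Pi\<^sub>M I (\<lambda>_. N))" for \<omega>
  proof -
    have "(\<integral>\<^sup>+g. ennreal (exp (\<Sum>k\<in>I. (a * g k) * \<xi> k \<omega>)) \<partial>Pi\<^sub>M I (\<lambda>_. N))
        = (\<integral>\<^sup>+g. (\<Prod>k\<in>I. ennreal (exp ((a * \<xi> k \<omega>) * g k))) \<partial>Pi\<^sub>M I (\<lambda>_. N))"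
      by (simp add: exp_sum[OF I] prod_ennreal mult_ac)
    also have "\<dots> = (\<Prod>k\<in>I. \<integral>\<^sup>+g. ennreal (exp ((a * \<xi> k \<omega>) * g)) \<partial>N)"
      by (rule PN.product_nn_integral_prod[OF I]) simp
    also have "\<dots> = (\<Prod>k\<in>I. ennreal (exp ((a * \<xi> k \<omega>)\<^sup>2 / 2)))"
      unfolding N_def nn_integral_std_normal_exp ..
    also have "\<dots> = ennreal (exp (\<Sum>k\<in>I. (a * \<xi> k \<omega>)\<^sup>2 / 2))"
      by (simp add: exp_sum[OF I] prod_ennreal)
    also have "(\<Sum>k\<in>I. (a * \<xi> k \<omega>)\<^sup>2 / 2) = \<kappa> * (\<Sum>k\<in>I. (\<xi> k \<omega>)\<^sup>2)"
      by (simp add: power_mult_distrib a2 sum_distrib_left)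
    finally show ?thesis ..
  qed
  have "(\<integral>\<^sup>+\<omega>. ennreal (exp (\<kappa> * (\<Sum>k\<in>I. (\<xi> k \<omega>)\<^sup>2))) \<partial>M)
      = (\<integral>\<^sup>+g. \<integral>\<^sup>+\<omega>. ennreal (exp (\<Sum>k\<in>I. (a * g k) * \<xi> k \<omega>)) \<partial>M \<partial>Pi\<^sub>M I (\<lambda>_. N))"
    unfolding expand by (rule P2.Fubini'[symmetric]) measurable
  \<comment> \<open>For fixed \<open>g\<close> the coefficients \<open>a * g k\<close> are
    deterministic, so \<open>mgf\<close> applies. What remains is a product of moments of squared
    Gaussians, finite because \<open>2 * \<kappa> * \<gamma>\<^sup>2 < 1\<close>.\<close>
  also have "\<dots> \<le> (\<integral>\<^sup>+g. ennreal (exp (\<gamma>\<^sup>2 * (\<Sum>k\<in>I. (a * g k)\<^sup>2) / 2)) \<partial>Pi\<^sub>M I (\<lambda>_. N))"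
    by (intro nn_integral_mono mgf)
  also have "\<dots> = (\<integral>\<^sup>+g. (\<Prod>k\<in>I. ennreal (exp ((2 * \<kappa> * \<gamma>\<^sup>2) * (g k)\<^sup>2 / 2))) \<partial>Pi\<^sub>M I (\<lambda>_. N))"
  proof (intro nn_integral_cong)
    fix g :: "'k \<Rightarrow> real"
    have "\<gamma>\<^sup>2 * (\<Sum>k\<in>I. (a * g k)\<^sup>2) / 2 = (\<Sum>k\<in>I. (2 * \<kappa> * \<gamma>\<^sup>2) * (g k)\<^sup>2 / 2)"
      by (simp add: power_mult_distrib a2 sum_distrib_left sum_divide_distrib mult_ac)
    then show "ennreal (exp (\<gamma>\<^sup>2 * (\<Sum>k\<in>I. (a * g k)\<^sup>2) / 2))
        = (\<Prod>k\<in>I. ennreal (exp ((2 * \<kappa> * \<gamma>\<^sup>2) * (g k)\<^sup>2 / 2)))"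
      by (simp only: exp_sum[OF I]) (simp add: prod_ennreal)
  qed
  also have "\<dots> = (\<Prod>k\<in>I. \<integral>\<^sup>+g. ennreal (exp ((2 * \<kappa> * \<gamma>\<^sup>2) * g\<^sup>2 / 2)) \<partial>N)"
    by (rule PN.product_nn_integral_prod[OF I]) simp
  also have "\<dots> = (\<Prod>k\<in>I. ennreal (1 / sqrt (1 - 2 * \<kappa> * \<gamma>\<^sup>2)))"
    unfolding N_def nn_integral_std_normal_exp_square[OF \<kappa>(2)] ..
  also have "\<dots> = ennreal ((1 / sqrt (1 - 2 * \<kappa> * \<gamma>\<^sup>2)) ^ card I)"
    using \<kappa> by (simp add: ennreal_power)
  finally show ?thesis .
qed

text \<open>Chernoff's bound for the sum of squares. Only joint exponential moments of linear forms
  enter, so the coordinates may be dependent. The threshold, with coefficient 1 on both roots, has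
  exactly the shape that occurs in \<open>lambda_bar\<close>.\<close>

lemma subgaussian_norm_tail:
  fixes \<xi> :: "'k \<Rightarrow> 'a \<Rightarrow> real"
  assumes I: "finite I" "I \<noteq> {}" and meas: "\<And>k. k \<in> I \<Longrightarrow> \<xi> k \<in> borel_measurable M"
    and mgf: "\<And>t. (\<integral>\<^sup>+\<omega>. ennreal (exp (\<Sum>k\<in>I. t k * \<xi> k \<omega>)) \<partial>M)
      \<le> ennreal (exp (\<gamma>\<^sup>2 * (\<Sum>k\<in>I. (t k)\<^sup>2) / 2))"
    and "0 < \<gamma>" "0 < t"
  shows "prob {\<omega> \<in> space M. \<gamma> * (sqrt (real (card I)) + sqrt (2 * t)) \<le> sqrt (\<Sum>k\<in>I. (\<xi> k \<omega>)\<^sup>2)}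
    \<le> exp (- t)"
proof -
  define d where "d = real (card I)"
  have d: "0 < d" using I by (simp add: d_def card_gt_0_iff)
  \<comment> \<open>\<open>r\<close> is the ratio of the threshold to its \<open>sqrt d\<close> part; \<open>2 * \<kappa> * \<gamma>\<^sup>2 = 1 - 1 / r\<close> is a
    near-optimal Chernoff parameter for which the exponent collapses by \<open>ln r \<le> r - 1\<close>.\<close>
  define r where "r = 1 + sqrt (2 * t / d)"
  have r: "1 < r" using d \<open>0 < t\<close> by (simp add: r_def)
  define \<kappa> where "\<kappa> = (1 - 1 / r) / (2 * \<gamma>\<^sup>2)"
  have \<kappa>\<gamma>: "2 * \<kappa> * \<gamma>\<^sup>2 = 1 - 1 / r" using \<open>0 < \<gamma>\<close> by (simp add: \<kappa>_def)
  have \<kappa>: "0 < \<kappa>" "1 - 2 * \<kappa> * \<gamma>\<^sup>2 = 1 / r"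
    using r \<open>0 < \<gamma>\<close> by (simp add: \<kappa>_def) (simp add: \<kappa>\<gamma>)
  define b where "b = \<gamma> * (sqrt d + sqrt (2 * t))"
  have b: "b = \<gamma> * sqrt d * r" "0 \<le> b"
  proof -
    have "sqrt (2 * t) = sqrt d * sqrt (2 * t / d)" using d by (simp add: real_sqrt_mult[symmetric])
    then show "b = \<gamma> * sqrt d * r" by (simp add: b_def r_def algebra_simps)
    show "0 \<le> b" using d \<open>0 < \<gamma>\<close> \<open>0 < t\<close> by (simp add: b_def)
  qed
  have [measurable]: "\<And>k. k \<in> I \<Longrightarrow> \<xi> k \<in> borel_measurable M" by (rule meas)
  define S where "S \<omega> = (\<Sum>k\<in>I. (\<xi> k \<omega>)\<^sup>2)" for \<omega>
  have S [measurable]: "S \<in> borel_measurable M" by (simp add: S_def[abs_def])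
  have S_exp: "(\<integral>\<^sup>+\<omega>. ennreal (exp (\<kappa> * S \<omega>)) \<partial>M) \<le> ennreal (sqrt r ^ card I)"
  proof -
    have "(\<integral>\<^sup>+\<omega>. ennreal (exp (\<kappa> * S \<omega>)) \<partial>M) \<le> ennreal ((1 / sqrt (1 - 2 * \<kappa> * \<gamma>\<^sup>2)) ^ card I)"
      unfolding S_def
    proof (rule nn_integral_exp_sum_squares_le[OF I(1) meas mgf])
      show "2 * \<kappa> * \<gamma>\<^sup>2 < 1" using \<kappa>\<gamma> r by simp
    qed (use \<kappa> in auto)
    then show ?thesis unfolding \<kappa>(2) using r by (simp add: real_sqrt_divide)
  qed
  define F where "F = {\<omega> \<in> space M. b \<le> sqrt (S \<omega>)}"
  have "emeasure M F \<le> emeasure M {\<omega> \<in> space M. b\<^sup>2 \<le> S \<omega>}"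
  proof (rule emeasure_mono)
    show "F \<subseteq> {\<omega> \<in> space M. b\<^sup>2 \<le> S \<omega>}"
    proof
      fix \<omega> assume "\<omega> \<in> F"
      then have \<omega>: "\<omega> \<in> space M" "b \<le> sqrt (S \<omega>)" by (auto simp: F_def)
      have "0 \<le> S \<omega>" by (simp add: S_def sum_nonneg)
      then show "\<omega> \<in> {\<omega> \<in> space M. b\<^sup>2 \<le> S \<omega>}"
        using \<omega> b(2) power_mono[of b "sqrt (S \<omega>)" 2] by simp
    qed
  qed measurable
  also have "\<dots> \<le> ennreal (exp (- \<kappa> * b\<^sup>2)) * (\<integral>\<^sup>+\<omega>. ennreal (exp (\<kappa> * S \<omega>)) * indicator (space M) \<omega> \<partial>M)"
    by (rule Chernoff_ineq_nn_integral_ge[OF \<kappa>(1)]) simp_all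
  also have "(\<integral>\<^sup>+\<omega>. ennreal (exp (\<kappa> * S \<omega>)) * indicator (space M) \<omega> \<partial>M)
      = (\<integral>\<^sup>+\<omega>. ennreal (exp (\<kappa> * S \<omega>)) \<partial>M)"
    by (intro nn_integral_cong) auto
  also have "ennreal (exp (- \<kappa> * b\<^sup>2)) * \<dots> \<le> ennreal (exp (- \<kappa> * b\<^sup>2)) * ennreal (sqrt r ^ card I)"
    by (rule mult_left_mono[OF S_exp]) simp
  also have "ennreal (exp (- \<kappa> * b\<^sup>2)) * ennreal (sqrt r ^ card I) = ennreal (exp (- \<kappa> * b\<^sup>2) * sqrt r ^ card I)"
    using r by (simp add: ennreal_mult)
  also have "exp (- \<kappa> * b\<^sup>2) * sqrt r ^ card I \<le> exp (- t)"
  proof -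
    have "sqrt r = exp (ln r / 2)"
    proof -
      have "exp (ln (sqrt r)) = sqrt r" using r by (intro exp_ln) simp
      then show ?thesis using r by (simp add: ln_sqrt)
    qed
    then have "sqrt r ^ card I = exp (d * (ln r / 2))" by (simp only: d_def exp_of_nat_mult)
    \<comment> \<open>The threshold contributes d/2 (r^2 - r) and the moment at most d/2 (r - 1);
      the difference d/2 (r - 1)^2 equals \<open>t\<close> by the choice of
      \<open>r\<close>.\<close>
    moreover have "\<kappa> * b\<^sup>2 = d / 2 * (r\<^sup>2 - r)"
      using r d \<open>0 < \<gamma>\<close> by (simp add: b \<kappa>_def power_mult_distrib) (simp add: power2_eq_square field_simps)
    moreover have "d * (ln r / 2) \<le> d / 2 * (r - 1)"
      using d r ln_le_minus_one[of r] by simp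
    moreover have "d / 2 * (r - 1)\<^sup>2 = t" using d \<open>0 < t\<close> by (simp add: r_def)
    ultimately have "exp (- \<kappa> * b\<^sup>2) * sqrt r ^ card I = exp (- (d / 2 * (r\<^sup>2 - r)) + d * (ln r / 2))"
      by (simp add: exp_add[symmetric])
    also have "\<dots> \<le> exp (- t)"
      using \<open>d * (ln r / 2) \<le> d / 2 * (r - 1)\<close> \<open>d / 2 * (r - 1)\<^sup>2 = t\<close>
      by (simp add: power2_eq_square algebra_simps)
    finally show ?thesis .
  qed
  finally have "emeasure M F \<le> ennreal (exp (- t))" by (simp add: ennreal_leI)
  then have "prob F \<le> exp (- t)" by (simp add: emeasure_eq_measure)
  then show ?thesis by (simp add: F_def b_def S_def d_def)
qed

lemma nn_integral_exp_sum_indep: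
  fixes Y :: "'i \<Rightarrow> 'a \<Rightarrow> real"
  assumes "finite I" "indep_vars (\<lambda>_. borel) Y I"
  shows "(\<integral>\<^sup>+\<omega>. ennreal (exp (\<Sum>i\<in>I. Y i \<omega>)) \<partial>M) = (\<Prod>i\<in>I. \<integral>\<^sup>+\<omega>. ennreal (exp (Y i \<omega>)) \<partial>M)"
proof -
  have "(\<integral>\<^sup>+\<omega>. ennreal (exp (\<Sum>i\<in>I. Y i \<omega>)) \<partial>M) = (\<integral>\<^sup>+\<omega>. (\<Prod>i\<in>I. ennreal (exp (Y i \<omega>))) \<partial>M)"
    by (simp add: exp_sum[OF assms(1)] prod_ennreal)
  also have "\<dots> = (\<Prod>i\<in>I. \<integral>\<^sup>+\<omega>. ennreal (exp (Y i \<omega>)) \<partial>M)"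
    by (intro indep_vars_nn_integral assms(1) indep_vars_compose2[OF assms(2)]) auto
  finally show ?thesis .
qed

lemma subgaussian_nn_integral:
  assumes "subgaussian \<gamma> Z"
  shows "(\<integral>\<^sup>+\<omega>. ennreal (exp (t * Z \<omega>)) \<partial>M) \<le> ennreal (exp (\<gamma>\<^sup>2 * t\<^sup>2 / 2))"
  using assms by (simp add: subgaussian_def nn_integral_eq_integral)

text \<open>The definition speaks of unit vectors only. Rescaling yields every nonzero
  \<open>u\<close>; the zero vector cannot be normalised and is treated apart.\<close>

lemma subgaussian_vec_nn_integral:
  assumes Z: "subgaussian_vec k \<gamma> Z" "\<And>\<omega>. \<omega> \<in> space M \<Longrightarrow> Z \<omega> \<in> carrier_vec k"
    and u: "u \<in> carrier_vec k"
  shows "(\<integral>\<^sup>+\<omega>. ennreal (exp (t * (u \<bullet> Z \<omega>))) \<partial>M) \<le> ennreal (exp ((\<gamma> * vec_norm2 u)\<^sup>2 * t\<^sup>2 / 2))"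
proof (cases "u = 0\<^sub>v k")
  case True
  have "(\<integral>\<^sup>+\<omega>. ennreal (exp (t * (u \<bullet> Z \<omega>))) \<partial>M) = (\<integral>\<^sup>+\<omega>. 1 \<partial>M)"
    using Z(2) by (intro nn_integral_cong) (simp add: True)
  then show ?thesis by (simp add: True emeasure_space_1)
next
  case False
  then have pos: "0 < vec_norm2 u" using vec_norm2_eq_0_iff[OF u] by (simp add: less_le)
  define w where "w = (1 / vec_norm2 u) \<cdot>\<^sub>v u"
  have w: "w \<in> carrier_vec k" "vec_norm2 w = 1" using u pos by (auto simp: w_def vec_norm2_smult)
  have "subgaussian \<gamma> (\<lambda>\<omega>. w \<bullet> Z \<omega>)" using Z(1) w by (simp add: subgaussian_vec_def)
  note subgaussian_nn_integral[OF this, of "t * vec_norm2 u"]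
  moreover have "(\<integral>\<^sup>+\<omega>. ennreal (exp (t * vec_norm2 u * (w \<bullet> Z \<omega>))) \<partial>M)
      = (\<integral>\<^sup>+\<omega>. ennreal (exp (t * (u \<bullet> Z \<omega>))) \<partial>M)"
    using Z(2) u pos by (intro nn_integral_cong) (simp add: w_def)
  ultimately show ?thesis by (simp add: power_mult_distrib mult_ac)
qed

text \<open>Rows are independent as vectors, with nothing claimed about the entries inside a row; a
  linear functional of each row inherits this independence.\<close>

lemma row_combination_indep:
  assumes indep: "indep_vars (\<lambda>_. \<Pi>\<^sub>M k\<in>{..<c}. borel) (row_entries c Z) {..<r}"
  shows "indep_vars (\<lambda>_. borel) (\<lambda>i \<omega>. \<Sum>k<c. b i k * Z \<omega> $$ (i, k)) {..<r}"
proof -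
  have "indep_vars (\<lambda>_. borel) (\<lambda>i \<omega>. (\<lambda>x. \<Sum>k<c. b i k * x k) (row_entries c Z i \<omega>)) {..<r}"
    by (rule indep_vars_compose2[OF indep]) measurable
  then show ?thesis by (simp add: row_entries_def)
qed

section \<open>Measurability of norms of random products\<close>

lemma random_matrix_entry_measurable:
  "random_matrix M r c Z \<Longrightarrow> i < r \<Longrightarrow> j < c \<Longrightarrow> (\<lambda>\<omega>. Z \<omega> $$ (i, j)) \<in> borel_measurable M"
  by (simp add: random_matrix_def)

lemma random_matrix_carrier: "random_matrix M r c Z \<Longrightarrow> \<omega> \<in> space M \<Longrightarrow> Z \<omega> \<in> carrier_mat r c"
  by (simp add: random_matrix_def)

lemma vec_norm2_transpose_mult_eq:
  assumes "Z \<in> carrier_mat r c" "x \<in> carrier_vec r"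
  shows "vec_norm2 (transpose_mat Z *\<^sub>v x) = sqrt (\<Sum>k<c. (\<Sum>i<r. x $ i * Z $$ (i, k))\<^sup>2)"
proof -
  have "(transpose_mat Z *\<^sub>v x) $ k = (\<Sum>i<r. x $ i * Z $$ (i, k))" if "k < c" for k
    using assms that by (simp add: scalar_prod_def atLeast0LessThan mult.commute)
  then show ?thesis
    using assms by (simp add: vec_norm2_eq_L2_set L2_set_def)
qed

lemma vec_norm2_mult_eq:
  assumes "Z \<in> carrier_mat r c" "x \<in> carrier_vec c"
  shows "vec_norm2 (Z *\<^sub>v x) = sqrt (\<Sum>i<r. (\<Sum>k<c. x $ k * Z $$ (i, k))\<^sup>2)"
  using vec_norm2_transpose_mult_eq[of "transpose_mat Z" c r x] assms by simp

lemma vec_norm2_mult_measurable: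
  assumes "random_matrix M r c Z" "x \<in> carrier_vec c"
  shows "(\<lambda>\<omega>. vec_norm2 (Z \<omega> *\<^sub>v x)) \<in> borel_measurable M"
proof -
  have [measurable]: "\<And>i k. i < r \<Longrightarrow> k < c \<Longrightarrow> (\<lambda>\<omega>. Z \<omega> $$ (i, k)) \<in> borel_measurable M"
    by (rule random_matrix_entry_measurable[OF assms(1)])
  have "(\<lambda>\<omega>. sqrt (\<Sum>i<r. (\<Sum>k<c. x $ k * Z \<omega> $$ (i, k))\<^sup>2)) \<in> borel_measurable M"
    by measurable
  then show ?thesis
    by (subst measurable_cong[OF vec_norm2_mult_eq]) (auto intro: random_matrix_carrier assms)
qed

lemma vec_norm2_transpose_mult_measurable:
  assumes "random_matrix M r c Z" "x \<in> carrier_vec r"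
  shows "(\<lambda>\<omega>. vec_norm2 (transpose_mat (Z \<omega>) *\<^sub>v x)) \<in> borel_measurable M"
proof (rule vec_norm2_mult_measurable)
  show "random_matrix M c r (\<lambda>\<omega>. transpose_mat (Z \<omega>))"
    unfolding random_matrix_def
  proof (intro conjI ballI allI impI)
    fix i j assume ij: "i < c" "j < r"
    have "(\<lambda>\<omega>. Z \<omega> $$ (j, i)) \<in> borel_measurable M"
      using assms(1) ij by (intro random_matrix_entry_measurable)
    then show "(\<lambda>\<omega>. transpose_mat (Z \<omega>) $$ (i, j)) \<in> borel_measurable M"
    proof (subst measurable_cong)
      fix \<omega> assume "\<omega> \<in> space M"
      from random_matrix_carrier[OF assms(1) this]
      show "transpose_mat (Z \<omega>) $$ (i, j) = Z \<omega> $$ (j, i)" using ij by simp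
    qed
  qed (use random_matrix_carrier[OF assms(1)] in auto)
qed (rule assms)

end

section \<open>A lattice net of the unit ball\<close>

text \<open>The integer points in the ball of radius 2 sqrt k. The scaling in \<open>net_vec\<close>
  maps this ball to the unit ball and the mesh to 1 / (2 sqrt k), fine enough for k coordinatewise
  rounding errors to have total Euclidean length at most 1/2. Extensionality of the functions keeps
  the set finite.\<close>

definition lattice_net :: "nat \<Rightarrow> (nat \<Rightarrow> int) set" where
  "lattice_net k = {z \<in> {..<k} \<rightarrow>\<^sub>E UNIV. (\<Sum>i<k. (z i)\<^sup>2) \<le> 4 * int k}"

definition net_vec :: "nat \<Rightarrow> (nat \<Rightarrow> int) \<Rightarrow> real vec" where
  "net_vec k z = Matrix.vec k (\<lambda>i. real_of_int (z i) / (2 * sqrt (real k)))"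

lemma net_vec_carrier [simp]: "net_vec k z \<in> carrier_vec k"
  by (simp add: net_vec_def)

text \<open>The modulus of an integer is at most its square, which confines every coordinate. The
  box may be crude: it serves for finiteness and for factoring the weighted count.\<close>

lemma lattice_net_subset: "lattice_net k \<subseteq> {..<k} \<rightarrow>\<^sub>E {- int (4 * k)..int (4 * k)}"
proof
  fix z assume z: "z \<in> lattice_net k"
  have "\<bar>z i\<bar> \<le> 4 * int k" if "i < k" for i
  proof -
    have "\<bar>z i\<bar> \<le> (z i)\<^sup>2" 
      using mult_left_mono[of 1 "\<bar>z i\<bar>" "\<bar>z i\<bar>"]
      by (cases "z i = 0") (auto simp: power2_eq_square abs_mult_self_eq)
    also have "\<dots> \<le> (\<Sum>i<k. (z i)\<^sup>2)" using that by (intro member_le_sum) auto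
    also have "\<dots> \<le> 4 * int k" using z by (simp add: lattice_net_def)
    finally show ?thesis .
  qed
  then show "z \<in> {..<k} \<rightarrow>\<^sub>E {- int (4 * k)..int (4 * k)}"
    using z by (auto simp: lattice_net_def PiE_iff abs_le_iff minus_le_iff)
qed

lemma finite_lattice_net: "finite (lattice_net k)"
  by (rule finite_subset[OF lattice_net_subset]) (auto intro: finite_PiE)

text \<open>The correction \<open>2 * (1 / 2) ^ N\<close> closes the induction, since the two new
  terms together are at most \<open>(1 / 2) ^ N\<close>. What matters is the bound 3, uniform in
  \<open>N\<close>.\<close>

lemma sum_exp_neg_square_le: "(\<Sum>a = - int N..int N. exp (- (real_of_int a)\<^sup>2)) \<le> 3 - 2 * (1 / 2) ^ N"
proof (induction N)
  case (Suc N)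
  have "{- int (Suc N)..int (Suc N)} = insert (- int (Suc N)) (insert (int (Suc N)) {- int N..int N})"
    by auto
  then have "(\<Sum>a = - int (Suc N)..int (Suc N). exp (- (real_of_int a)\<^sup>2))
      = 2 * exp (- (real (Suc N))\<^sup>2) + (\<Sum>a = - int N..int N. exp (- (real_of_int a)\<^sup>2))"
    by (simp add: power2_eq_square algebra_simps)
  moreover have "exp (- (real (Suc N))\<^sup>2) \<le> (1 / 2) ^ Suc N"
  proof -
    have "exp (- (real (Suc N))\<^sup>2) \<le> exp (real (Suc N) * (- 1))"
      by (simp add: power2_eq_square algebra_simps)
    also have "\<dots> = exp (- 1) ^ Suc N" by (rule exp_of_nat_mult)
    also have "\<dots> \<le> (1 / 2) ^ Suc N"
      using exp_ge_add_one_self[of 1] by (intro power_mono) (auto simp: exp_minus field_simps)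
    finally show ?thesis .
  qed
  ultimately show ?case using Suc by simp
qed simp

text \<open>Counting lattice points with Gaussian weights avoids any volume computation.\<close>

lemma card_lattice_net_le: "real (card (lattice_net k)) \<le> exp (6 * real k)"
proof -
  define box where "box = {- int (4 * k)..int (4 * k)}"
  have "real (card (lattice_net k)) = (\<Sum>z\<in>lattice_net k. 1)" by simp
  \<comment> \<open>On the net the sum of squares is at most 4 k, so the Gaussian weight times
    \<open>exp (4 * real k)\<close> is at least 1.\<close>
  also have "\<dots> \<le> (\<Sum>z\<in>lattice_net k. exp (4 * real k) * (\<Prod>i<k. exp (- (real_of_int (z i))\<^sup>2)))"
  proof (rule sum_mono)
    fix z assume "z \<in> lattice_net k"
    then have "real_of_int (\<Sum>i<k. (z i)\<^sup>2) \<le> real_of_int (4 * int k)"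
      unfolding of_int_le_iff by (simp add: lattice_net_def)
    then have "0 \<le> 4 * real k + (\<Sum>i<k. - (real_of_int (z i))\<^sup>2)" by (simp add: sum_negf)
    then have "1 \<le> exp (4 * real k + (\<Sum>i<k. - (real_of_int (z i))\<^sup>2))" by simp
    then show "1 \<le> exp (4 * real k) * (\<Prod>i<k. exp (- (real_of_int (z i))\<^sup>2))"
      by (simp only: exp_add exp_sum[OF finite_lessThan])
  qed
  \<comment> \<open>Over the full box the sum of products factors into one-dimensional sums.\<close>
  also have "\<dots> \<le> (\<Sum>z\<in>{..<k} \<rightarrow>\<^sub>E box. exp (4 * real k) * (\<Prod>i<k. exp (- (real_of_int (z i))\<^sup>2)))"
    using lattice_net_subset
    by (intro sum_mono2 mult_nonneg_nonneg prod_nonneg) (auto simp: box_def intro: finite_PiE)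
  also have "\<dots> = exp (4 * real k) * (\<Prod>i<k. \<Sum>a\<in>box. exp (- (real_of_int a)\<^sup>2))"
    by (subst prod_sum_PiE) (auto simp: box_def sum_distrib_left)
  also have "\<dots> = exp (4 * real k) * (\<Sum>a\<in>box. exp (- (real_of_int a)\<^sup>2)) ^ k" by simp
  also have "\<dots> \<le> exp (4 * real k) * exp 2 ^ k"
  proof (intro mult_left_mono power_mono)
    have "(\<Sum>a\<in>box. exp (- (real_of_int a)\<^sup>2)) \<le> 3 - 2 * (1 / 2) ^ (4 * k)"
      unfolding box_def by (rule sum_exp_neg_square_le)
    also have "\<dots> \<le> 3" by simp
    also have "3 \<le> exp (2 :: real)" using exp_ge_add_one_self[of 2] by simp
    finally show "(\<Sum>a\<in>box. exp (- (real_of_int a)\<^sup>2)) \<le> exp 2" .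
  qed (auto intro: sum_nonneg)
  also have "\<dots> = exp (6 * real k)"
    by (simp add: exp_of_nat_mult[symmetric] exp_add[symmetric])
  finally show ?thesis .
qed

lemma net_vec_norm_le:
  assumes "0 < k" "z \<in> lattice_net k"
  shows "vec_norm2 (net_vec k z) \<le> 1"
proof -
  have "(vec_norm2 (net_vec k z))\<^sup>2 = (\<Sum>i<k. (real_of_int (z i) / (2 * sqrt (real k)))\<^sup>2)"
    by (subst vec_norm2_power2_sum[of _ k]) (simp_all add: net_vec_def)
  also have "\<dots> = real_of_int (\<Sum>i<k. (z i)\<^sup>2) / (4 * real k)"
    by (simp add: power_divide power_mult_distrib sum_divide_distrib)
  also have "\<dots> \<le> real_of_int (4 * int k) / (4 * real k)"
    using assms(2) unfolding lattice_net_def by (intro divide_right_mono) (simp_all only: of_int_le_iff, auto)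
  also have "\<dots> = 1\<^sup>2" using assms(1) by simp
  finally show ?thesis by (rule power2_le_imp_le) simp
qed

lemma lattice_net_approx:
  assumes k: "0 < k" and u: "u \<in> carrier_vec k" "vec_norm2 u \<le> 1"
  obtains z where "z \<in> lattice_net k" "vec_norm2 (u - net_vec k z) \<le> 1 / 2"
proof -
  define c where "c = 2 * sqrt (real k)"
  have c: "0 < c" "c\<^sup>2 = 4 * real k" using k by (auto simp: c_def power_mult_distrib)
  \<comment> \<open>rounding towards zero, so that the norm does not grow\<close>
  define r where "r x = (if 0 \<le> x then \<lfloor>x\<rfloor> else \<lceil>x\<rceil>)" for x :: real
  have r: "\<bar>real_of_int (r x)\<bar> \<le> \<bar>x\<bar>" "\<bar>x - real_of_int (r x)\<bar> \<le> 1" for x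
    unfolding r_def by (cases "0 \<le> x"; simp; linarith)+
  define z where "z = (\<lambda>i\<in>{..<k}. r (c * u $ i))"
  have "real_of_int (\<Sum>i<k. (z i)\<^sup>2) = (\<Sum>i<k. (real_of_int (r (c * u $ i)))\<^sup>2)"
    by (simp add: z_def)
  also have "\<dots> \<le> (\<Sum>i<k. (c * u $ i)\<^sup>2)"
    by (intro sum_mono) (simp add: r(1) flip: abs_le_square_iff)
  also have "\<dots> = c\<^sup>2 * (vec_norm2 u)\<^sup>2"
    by (simp add: vec_norm2_power2_sum[OF u(1)] power_mult_distrib sum_distrib_left)
  also have "\<dots> \<le> c\<^sup>2 * 1\<^sup>2" using u(2) by (intro mult_left_mono power_mono) auto
  finally have "real_of_int (\<Sum>i<k. (z i)\<^sup>2) \<le> real_of_int (4 * int k)" by (simp add: c)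
  then have z: "z \<in> lattice_net k"
    unfolding of_int_le_iff by (auto simp: lattice_net_def z_def)
  have "(vec_norm2 (u - net_vec k z))\<^sup>2 = (\<Sum>i<k. ((c * u $ i - real_of_int (r (c * u $ i))) / c)\<^sup>2)"
    using u c(1) by (subst vec_norm2_power2_sum[of _ k])
      (simp_all add: net_vec_def z_def diff_divide_distrib flip: c_def)
  also have "\<dots> \<le> (\<Sum>i<k. (1 / c)\<^sup>2)"
  proof (rule sum_mono)
    fix i
    have "\<bar>(c * u $ i - real_of_int (r (c * u $ i))) / c\<bar> \<le> 1 / c"
      using r(2)[of "c * u $ i"] c(1) by (simp add: divide_right_mono)
    then show "((c * u $ i - real_of_int (r (c * u $ i))) / c)\<^sup>2 \<le> (1 / c)\<^sup>2"
      using c(1) by (simp flip: abs_le_square_iff)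
  qed
  also have "\<dots> = (1 / 2)\<^sup>2" using k by (simp add: power_divide c)
  finally have "vec_norm2 (u - net_vec k z) \<le> 1 / 2" by (rule power2_le_imp_le) simp
  with z that show thesis by blast
qed

text \<open>Splitting a vector of the unit ball into a net point and a remainder of norm at most 1/2
  gives |A| \<le> \<beta> + |A| / 2, and the last term, being finite, is absorbed.\<close>

lemma op_norm_le_net:
  assumes A: "A \<in> carrier_mat r k" and k: "0 < k"
    and net: "\<And>z. z \<in> lattice_net k \<Longrightarrow> vec_norm2 (A *\<^sub>v net_vec k z) \<le> \<beta>"
  shows "op_norm A \<le> 2 * \<beta>"
proof -
  have "op_norm A \<le> \<beta> + op_norm A / 2"
    unfolding op_norm_def[of A]
  proof (rule cSUP_least)
    have "0\<^sub>v (dim_col A) \<in> {v \<in> carrier_vec (dim_col A). vec_norm2 v \<le> 1}" by simp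
    then show "{v \<in> carrier_vec (dim_col A). vec_norm2 v \<le> 1} \<noteq> {}" by blast
    fix u assume "u \<in> {v \<in> carrier_vec (dim_col A). vec_norm2 v \<le> 1}"
    then have u: "u \<in> carrier_vec k" "vec_norm2 u \<le> 1" using A by auto
    obtain z where z: "z \<in> lattice_net k" "vec_norm2 (u - net_vec k z) \<le> 1 / 2"
      using lattice_net_approx[OF k u] .
    let ?w = "u - net_vec k z"
    have w: "?w \<in> carrier_vec k" by (rule minus_carrier_vec[OF u(1) net_vec_carrier])
    have "u = net_vec k z + ?w" using u by (intro eq_vecI) (auto simp: net_vec_def)
    then have "A *\<^sub>v u = A *\<^sub>v (net_vec k z + ?w)" by (rule arg_cong)
    also have "\<dots> = A *\<^sub>v net_vec k z + A *\<^sub>v ?w"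
      by (rule mult_add_distrib_mat_vec[OF A net_vec_carrier w])
    finally have "vec_norm2 (A *\<^sub>v u) \<le> vec_norm2 (A *\<^sub>v net_vec k z) + vec_norm2 (A *\<^sub>v ?w)"
      using A w by (simp add: vec_norm2_triangle[of _ r])
    also have "\<dots> \<le> \<beta> + op_norm A * (1 / 2)"
      using vec_norm2_le_op_norm[OF A w] z(2) op_norm_nonneg[of A]
      by (intro add_mono net z(1)) (meson mult_left_mono order_trans)
    finally show "vec_norm2 (A *\<^sub>v u) \<le> \<beta> + (SUP v\<in>{v \<in> carrier_vec (dim_col A). vec_norm2 v \<le> 1}. vec_norm2 (A *\<^sub>v v)) / 2"
      by (simp add: op_norm_def)
  qed
  then show ?thesis by simp
qed

section \<open>The group lasso with a biased response\<close>

lemma row_restrict_rows: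
  assumes "D \<in> carrier_mat p m" "j < p"
  shows "row (restrict_rows S D) j = (if j \<in> S then row D j else 0\<^sub>v m)"
  using assms by (intro eq_vecI) (auto simp: restrict_rows_def)

lemma restrict_rows_carrier [simp]: "D \<in> carrier_mat p m \<Longrightarrow> restrict_rows S D \<in> carrier_mat p m"
  by (auto simp: restrict_rows_def)

lemma l1l2_norm_restrict_rows:
  assumes D: "D \<in> carrier_mat p m" and S: "S \<subseteq> {..<p}"
  shows "l1l2_norm (restrict_rows S D) = (\<Sum>j\<in>S. vec_norm2 (row D j))"
proof -
  have "l1l2_norm (restrict_rows S D) = (\<Sum>j<p. if j \<in> S then vec_norm2 (row D j) else 0)"
    using restrict_rows_carrier[OF D, of S]
    by (auto simp: l1l2_norm_def row_restrict_rows[OF D] intro!: sum.cong)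
  also have "\<dots> = (\<Sum>j\<in>{..<p} \<inter> S. vec_norm2 (row D j))" by (simp add: sum.inter_restrict)
  finally show ?thesis using S by (simp add: Int_absorb1)
qed

lemma frob_norm_restrict_rows:
  assumes D: "D \<in> carrier_mat p m" and S: "S \<subseteq> {..<p}"
  shows "(frob_norm (restrict_rows S D))\<^sup>2 = (\<Sum>j\<in>S. (vec_norm2 (row D j))\<^sup>2)"
proof -
  have "(frob_norm (restrict_rows S D))\<^sup>2 = (\<Sum>j<p. if j \<in> S then (vec_norm2 (row D j))\<^sup>2 else 0)"
    unfolding frob_norm_power2_rows[OF restrict_rows_carrier[OF D]]
    by (auto simp: row_restrict_rows[OF D] intro!: sum.cong)
  also have "\<dots> = (\<Sum>j\<in>{..<p} \<inter> S. (vec_norm2 (row D j))\<^sup>2)" by (simp add: sum.inter_restrict)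
  finally show ?thesis using S by (simp add: Int_absorb1)
qed

lemma l1l2_norm_restrict_rows_le_frob:
  assumes D: "D \<in> carrier_mat p m" and S: "S \<subseteq> {..<p}" "card S \<le> s"
  shows "l1l2_norm (restrict_rows S D) \<le> sqrt (real s) * frob_norm (restrict_rows S D)"
proof -
  have "(\<Sum>j\<in>S. \<bar>1\<bar> * \<bar>vec_norm2 (row D j)\<bar>)
      \<le> L2_set (\<lambda>_. 1) S * L2_set (\<lambda>j. vec_norm2 (row D j)) S"
    by (rule L2_set_mult_ineq)
  also have "L2_set (\<lambda>j. vec_norm2 (row D j)) S = frob_norm (restrict_rows S D)"
    unfolding L2_set_def frob_norm_restrict_rows[OF D S(1), symmetric] by simp
  also have "L2_set (\<lambda>_. 1) S * frob_norm (restrict_rows S D) \<le> sqrt (real s) * frob_norm (restrict_rows S D)"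
    using S(2) by (intro mult_right_mono) (simp_all add: L2_set_def)
  finally show ?thesis by (simp add: l1l2_norm_restrict_rows[OF D S(1)])
qed

text \<open>Clearing the denominator also covers a vanishing restriction. The quotients are bounded
  below by 0, which makes \<open>Inf\<close> a genuine lower bound.\<close>

lemma restricted_eig_le:
  assumes S: "S \<subseteq> {..<p}" "card S \<le> s" and D: "D \<in> re_cone p m S \<alpha>" and n: "0 < n"
  shows "restricted_eig n p m X s \<alpha> * sqrt (real n) * frob_norm (restrict_rows S D) \<le> frob_norm (X * D)"
proof (cases "frob_norm (restrict_rows S D) = 0")
  case False
  then have pos: "0 < frob_norm (restrict_rows S D)" by (simp add: less_le)
  let ?Q = "{frob_norm (X * D) / (sqrt (real n) * frob_norm (restrict_rows S D)) | S D.
            S \<subseteq> {..<p} \<and> card S \<le> s \<and> D \<in> re_cone p m S \<alpha>}"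
  have "bdd_below ?Q" by (rule bdd_belowI[of _ 0]) auto
  then have "restricted_eig n p m X s \<alpha> \<le> frob_norm (X * D) / (sqrt (real n) * frob_norm (restrict_rows S D))"
    unfolding restricted_eig_def using S D by (intro cInf_lower) auto
  then show ?thesis using pos n by (simp add: field_simps)
qed simp

text \<open>This is what makes the penalty level positive. If \<open>X\<close> vanished, the matrix
  with ones in row 0 and zeros elsewhere would lie in the cone of {0} and be annihilated by
  \<open>X\<close>, which a positive restricted eigenvalue forbids.\<close>

lemma restricted_eig_pos_imp_nonzero_col:
  assumes X: "X \<in> carrier_mat n p" and dims: "0 < n" "0 < p" "0 < m" "1 \<le> s"
    and pos: "0 < restricted_eig n p m X s 4"
  obtains j where "j < p" "col X j \<noteq> 0\<^sub>v n"
proof (rule ccontr)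
  assume "\<not> thesis"
  with that have zero: "col X j = 0\<^sub>v n" if "j < p" for j using \<open>j < p\<close> by blast
  define D where "D = Matrix.mat p m (\<lambda>(j, k). if j = 0 then 1 else 0 :: real)"
  have D: "D \<in> carrier_mat p m" by (simp add: D_def)
  have D0: "D $$ (0, 0) = 1" using dims by (simp add: D_def)
  then have r0: "row D 0 \<noteq> 0\<^sub>v m"
    using dims D by (metis index_row(1) carrier_matD index_zero_vec(1) zero_neq_one)
  then have r0': "0 < vec_norm2 (row D 0)"
    by (intro vec_norm2_pos[of _ m]) (use D dims in auto)
  have S: "{0} \<subseteq> {..<p}" "card {0::nat} \<le> s" using dims by auto
  have "l1l2_norm (restrict_rows ({..<p} - {0}) D) = (\<Sum>j\<in>{..<p} - {0}. 0)"
    unfolding l1l2_norm_restrict_rows[OF D Diff_subset]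
  proof (rule sum.cong)
    fix j assume "j \<in> {..<p} - {0}"
    then have "row D j = 0\<^sub>v m" by (intro eq_vecI) (auto simp: D_def)
    then show "vec_norm2 (row D j) = 0" by simp
  qed simp
  then have cone: "D \<in> re_cone p m {0} 4"
    using D D0 dims by (auto simp: re_cone_def)
  have "X * D = 0\<^sub>m n m"
  proof (rule eq_matI)
    fix i k assume ik: "i < dim_row (0\<^sub>m n m :: real mat)" "k < dim_col (0\<^sub>m n m :: real mat)"
    have "X $$ (i, j) = 0" if "j < p" for j
      using zero[OF that] X ik that by (metis carrier_matD index_col index_zero_mat(2) index_zero_vec(1))
    then have "row X i = 0\<^sub>v p" using X ik by (intro eq_vecI) auto
    then show "(X * D) $$ (i, k) = 0\<^sub>m n m $$ (i, k)" using X D ik by simp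
  qed (use X D in auto)
  moreover have "frob_norm (0\<^sub>m n m) = 0" by (simp add: frob_norm_def)
  ultimately have "restricted_eig n p m X s 4 * sqrt (real n) * frob_norm (restrict_rows {0} D) \<le> 0"
    using restricted_eig_le[OF S cone dims(1), of X] by simp
  then have "frob_norm (restrict_rows {0} D) \<le> 0"
    using pos dims by (simp add: mult_le_0_iff)
  then have "frob_norm (restrict_rows {0} D) = 0" by (simp add: antisym)
  then have "(vec_norm2 (row D 0))\<^sup>2 = 0" using frob_norm_restrict_rows[OF D S(1)] by simp
  with r0' show False by simp
qed

lemma minus_minus_cancel_mat:
  fixes Y :: "'a :: ab_group_add mat"
  assumes "Y \<in> carrier_mat r c" "A \<in> carrier_mat r c" "B \<in> carrier_mat r c"
  shows "Y - A = (Y - B) - (A - B)"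
  using assms by (intro eq_matI) auto

lemma add_minus_cancel_vec:
  fixes v :: "'a :: ab_group_add vec"
  assumes "v \<in> carrier_vec k" "w \<in> carrier_vec k"
  shows "v = w + (v - w)"
  using assms by (intro eq_vecI) auto

lemma frob_norm_minus_power2:
  assumes A: "A \<in> carrier_mat r c" and B: "B \<in> carrier_mat r c"
  shows "(frob_norm (A - B))\<^sup>2
    = (frob_norm A)\<^sup>2 - 2 * (\<Sum>i<r. \<Sum>j<c. A $$ (i, j) * B $$ (i, j)) + (frob_norm B)\<^sup>2"
proof -
  have AB: "A - B \<in> carrier_mat r c" using B by (rule minus_carrier_mat)
  have "(frob_norm (A - B))\<^sup>2 = (\<Sum>i<r. \<Sum>j<c. (A $$ (i, j))\<^sup>2 - 2 * (A $$ (i, j) * B $$ (i, j)) + (B $$ (i, j))\<^sup>2)"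
    unfolding frob_norm_power2[OF AB] using A B
    by (intro sum.cong refl) (simp add: power2_eq_square algebra_simps)
  then show ?thesis
    by (simp add: frob_norm_power2[OF A] frob_norm_power2[OF B] sum.distrib sum_subtractf sum_distrib_left)
qed

lemma mat_inner_le_frob:
  assumes A: "A \<in> carrier_mat r c" and B: "B \<in> carrier_mat r c"
  shows "(\<Sum>i<r. \<Sum>j<c. A $$ (i, j) * B $$ (i, j)) \<le> frob_norm A * frob_norm B"
proof -
  have "(\<Sum>i<r. \<Sum>j<c. A $$ (i, j) * B $$ (i, j)) = (\<Sum>ij\<in>{..<r} \<times> {..<c}. A $$ ij * B $$ ij)"
    by (simp add: sum.cartesian_product)
  also have "\<dots> \<le> (\<Sum>ij\<in>{..<r} \<times> {..<c}. \<bar>A $$ ij\<bar> * \<bar>B $$ ij\<bar>)"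
    by (intro sum_mono) (simp flip: abs_mult)
  also have "\<dots> \<le> L2_set (\<lambda>ij. A $$ ij) ({..<r} \<times> {..<c}) * L2_set (\<lambda>ij. B $$ ij) ({..<r} \<times> {..<c})"
    by (rule L2_set_mult_ineq)
  also have "\<dots> = frob_norm A * frob_norm B"
    using A B by (simp add: frob_norm_def L2_set_def sum.cartesian_product)
  finally show ?thesis .
qed

text \<open>\<open>X\<close> is moved to the other factor and the sum is grouped by the rows of
  \<open>D\<close>, so that Cauchy-Schwarz in each row pairs the noise with the l1/l2
  penalty.\<close>

lemma mat_inner_mult_adjoint:
  fixes N :: "real mat"
  assumes N: "N \<in> carrier_mat n m" and X: "X \<in> carrier_mat n p" and D: "D \<in> carrier_mat p m"
  shows "(\<Sum>i<n. \<Sum>k<m. N $$ (i, k) * (X * D) $$ (i, k))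
    = (\<Sum>j<p. (transpose_mat N *\<^sub>v col X j) \<bullet> row D j)"
proof -
  have XD: "(X * D) $$ (i, k) = (\<Sum>j<p. X $$ (i, j) * D $$ (j, k))" if "i < n" "k < m" for i k
    using that X D by (simp add: scalar_prod_def atLeast0LessThan)
  have NX: "(transpose_mat N *\<^sub>v col X j) \<bullet> row D j = (\<Sum>k<m. (\<Sum>i<n. N $$ (i, k) * X $$ (i, j)) * D $$ (j, k))"
    if "j < p" for j
    using that N X D by (simp add: scalar_prod_def atLeast0LessThan)
  have "(\<Sum>i<n. \<Sum>k<m. N $$ (i, k) * (X * D) $$ (i, k))
      = (\<Sum>i<n. \<Sum>k<m. \<Sum>j<p. N $$ (i, k) * (X $$ (i, j) * D $$ (j, k)))"
    by (simp add: XD sum_distrib_left)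
  also have "\<dots> = (\<Sum>i<n. \<Sum>j<p. \<Sum>k<m. N $$ (i, k) * (X $$ (i, j) * D $$ (j, k)))"
    by (intro sum.cong refl sum.swap)
  also have "\<dots> = (\<Sum>j<p. \<Sum>i<n. \<Sum>k<m. N $$ (i, k) * (X $$ (i, j) * D $$ (j, k)))"
    by (rule sum.swap)
  also have "\<dots> = (\<Sum>j<p. \<Sum>k<m. \<Sum>i<n. N $$ (i, k) * (X $$ (i, j) * D $$ (j, k)))"
    by (intro sum.cong refl sum.swap)
  also have "\<dots> = (\<Sum>j<p. (transpose_mat N *\<^sub>v col X j) \<bullet> row D j)"
    by (intro sum.cong refl) (simp add: NX sum_distrib_right mult.assoc)
  finally show ?thesis .
qed

text \<open>Optimality is compared with \<open>T'\<close> and the cross term is split: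
  \<open>N1\<close> meets X (T - T') through Frobenius norms, \<open>N2\<close> meets T - T' through
  the mixed norm. The factor 2 of the expansion turns the bound on \<open>N2\<close> into (1 +
  \<eta>)/2 times (a + c); adding the penalty difference a - c yields the two coefficients.\<close>

lemma group_lasso_basic_inequality:
  assumes X: "X \<in> carrier_mat n p" and Y: "Y \<in> carrier_mat n m" and n: "0 < n"
    and T: "T \<in> carrier_mat p m" "T' \<in> carrier_mat p m"
    and S: "S \<subseteq> {..<p}" and zero: "\<And>j. j < p \<Longrightarrow> j \<notin> S \<Longrightarrow> row T' j = 0\<^sub>v m"
    and opt: "(1 / real n) * (frob_norm (Y - X * T))\<^sup>2 + lam * l1l2_norm T
      \<le> (1 / real n) * (frob_norm (Y - X * T'))\<^sup>2 + lam * l1l2_norm T'"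
    and lam: "0 < lam"
    and N: "N1 \<in> carrier_mat n m" "N2 \<in> carrier_mat n m" "Y - X * T' = N1 + N2"
    and N1: "frob_norm N1 \<le> sqrt (real n) * b"
    and N2: "\<And>j. j < p \<Longrightarrow> vec_norm2 (transpose_mat N2 *\<^sub>v col X j) \<le> real n * lam * (1 + \<eta>) / 4"
  defines "d \<equiv> frob_norm (X * (T - T')) / sqrt (real n)"
    and "a \<equiv> (\<Sum>j\<in>S. vec_norm2 (row (T - T') j))"
    and "c \<equiv> (\<Sum>j\<in>{..<p} - S. vec_norm2 (row (T - T') j))"
  shows "d\<^sup>2 \<le> 2 * b * d + lam * ((3 + \<eta>) / 2 * a - (1 - \<eta>) / 2 * c)"
proof -
  define D where "D = T - T'"
  have D: "D \<in> carrier_mat p m" using T by (auto simp: D_def)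
  have XD: "X * D \<in> carrier_mat n m" using X D by simp
  have NN: "N1 + N2 \<in> carrier_mat n m" using N by simp
  have split: "(\<Sum>j<p. f j) = (\<Sum>j\<in>S. f j) + (\<Sum>j\<in>{..<p} - S. f j)" for f :: "nat \<Rightarrow> real"
    using sum.subset_diff[OF S finite_lessThan, of f] by simp
  have "Y - X * T = (N1 + N2) - X * D"
  proof -
    have XT: "X * T \<in> carrier_mat n m" "X * T' \<in> carrier_mat n m" using X T by auto
    have "X * D = X * T - X * T'" unfolding D_def by (rule mult_minus_distrib_mat[OF X T])
    moreover have "Y - X * T = (Y - X * T') - (X * T - X * T')"
      by (rule minus_minus_cancel_mat[OF Y XT])
    ultimately show ?thesis by (simp only: N(3))
  qed
  then have expand: "(frob_norm (Y - X * T))\<^sup>2 = (frob_norm (N1 + N2))\<^sup>2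
      - 2 * (\<Sum>i<n. \<Sum>k<m. (N1 + N2) $$ (i, k) * (X * D) $$ (i, k)) + (frob_norm (X * D))\<^sup>2"
    by (simp only: frob_norm_minus_power2[OF NN XD])
  have "(\<Sum>i<n. \<Sum>k<m. (N1 + N2) $$ (i, k) * (X * D) $$ (i, k))
      = (\<Sum>i<n. \<Sum>k<m. N1 $$ (i, k) * (X * D) $$ (i, k)) + (\<Sum>i<n. \<Sum>k<m. N2 $$ (i, k) * (X * D) $$ (i, k))"
    unfolding sum.distrib[symmetric] using N by (intro sum.cong refl) (simp add: algebra_simps)
  also have "(\<Sum>i<n. \<Sum>k<m. N1 $$ (i, k) * (X * D) $$ (i, k)) \<le> (sqrt (real n) * b) * frob_norm (X * D)"
    by (intro order_trans[OF mat_inner_le_frob[OF N(1) XD]] mult_right_mono N1) simp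
  also have "(\<Sum>i<n. \<Sum>k<m. N2 $$ (i, k) * (X * D) $$ (i, k)) \<le> real n * lam * (1 + \<eta>) / 4 * (a + c)"
  proof -
    have "(\<Sum>i<n. \<Sum>k<m. N2 $$ (i, k) * (X * D) $$ (i, k))
        \<le> (\<Sum>j<p. real n * lam * (1 + \<eta>) / 4 * vec_norm2 (row D j))"
      unfolding mat_inner_mult_adjoint[OF N(2) X D]
    proof (rule sum_mono)
      fix j assume "j \<in> {..<p}"
      then have j: "j < p" by simp
      have v: "transpose_mat N2 *\<^sub>v col X j \<in> carrier_vec m" using N X j by auto
      have w: "row D j \<in> carrier_vec m" using D j by auto
      have "(transpose_mat N2 *\<^sub>v col X j) \<bullet> row D j
          \<le> vec_norm2 (transpose_mat N2 *\<^sub>v col X j) * vec_norm2 (row D j)"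
        using scalar_prod_le_vec_norm2[OF v w] by simp
      also have "\<dots> \<le> real n * lam * (1 + \<eta>) / 4 * vec_norm2 (row D j)"
        by (intro mult_right_mono N2 j) simp
      finally show "(transpose_mat N2 *\<^sub>v col X j) \<bullet> row D j \<le> real n * lam * (1 + \<eta>) / 4 * vec_norm2 (row D j)" .
    qed
    then show ?thesis
      unfolding sum_distrib_left[symmetric] split by (simp add: a_def c_def D_def)
  qed
  finally have cross: "(\<Sum>i<n. \<Sum>k<m. (N1 + N2) $$ (i, k) * (X * D) $$ (i, k))
      \<le> (sqrt (real n) * b) * frob_norm (X * D) + real n * lam * (1 + \<eta>) / 4 * (a + c)"
    by simp
  \<comment> \<open>On \<open>S\<close> this is the triangle inequality. Outside \<open>S\<close>
    the rows of \<open>T'\<close> vanish, so each row contributes exactly minus the norm of the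
    error row.\<close>
  have pen: "l1l2_norm T' - l1l2_norm T \<le> a - c"
  proof -
    have "l1l2_norm T' - l1l2_norm T = (\<Sum>j<p. vec_norm2 (row T' j) - vec_norm2 (row T j))"
      using T by (simp add: l1l2_norm_def sum_subtractf)
    also have "\<dots> \<le> (\<Sum>j\<in>S. vec_norm2 (row (T - T') j)) + (\<Sum>j\<in>{..<p} - S. - vec_norm2 (row (T - T') j))"
      unfolding split
    proof (intro add_mono sum_mono)
      fix j assume "j \<in> S"
      then have j: "j < p" using S by auto
      then have r: "row T j \<in> carrier_vec m" "row T' j \<in> carrier_vec m" using T by auto
      have rD: "row (T - T') j = row T j - row T' j" using T j by (intro eq_vecI) auto
      have "row T' j = row T j + (row T' j - row T j)" by (rule add_minus_cancel_vec[OF r(2,1)])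
      then have "vec_norm2 (row T' j) \<le> vec_norm2 (row T j) + vec_norm2 (row T' j - row T j)"
        using vec_norm2_triangle[OF r(1) minus_carrier_vec[OF r(2,1)]] by metis
      then show "vec_norm2 (row T' j) - vec_norm2 (row T j) \<le> vec_norm2 (row (T - T') j)"
        unfolding rD using vec_norm2_minus_commute[OF r] by simp
    next
      fix j assume "j \<in> {..<p} - S"
      then have j: "j < p" "j \<notin> S" by auto
      have "row (T - T') j = row T j - row T' j" using T j by (intro eq_vecI) auto
      also have "\<dots> = row T j" using T j zero[OF j] by (intro eq_vecI) auto
      finally show "vec_norm2 (row T' j) - vec_norm2 (row T j) \<le> - vec_norm2 (row (T - T') j)"
        using zero[OF j] by simp
    qed
    finally show ?thesis by (simp add: a_def c_def sum_negf)
  qed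
  have d: "frob_norm (X * D) = sqrt (real n) * d" using n by (simp add: d_def D_def)
  have "(1 / real n) * (frob_norm (Y - X * T))\<^sup>2
      \<le> (1 / real n) * (frob_norm (N1 + N2))\<^sup>2 + lam * (a - c)"
    using opt mult_left_mono[OF pen less_imp_le[OF lam]] N(3) by (simp add: algebra_simps)
  then have opt': "(frob_norm (Y - X * T))\<^sup>2 \<le> (frob_norm (N1 + N2))\<^sup>2 + real n * (lam * (a - c))"
    using n by (simp add: field_simps)
  \<comment> \<open>Stated for arbitrary reals, so that the long sums and norms enter the linear
    arithmetic as atoms.\<close>
  have combine: "xd \<le> 2 * (u + w) + z"
    if "fT \<le> fN + z" "fT = fN - 2 * ip + xd" "ip \<le> u + w" for fT fN z ip xd u w :: real
    using that by argo
  have "real n * d\<^sup>2 = (frob_norm (X * D))\<^sup>2" by (simp add: d power_mult_distrib)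
  also have "\<dots> \<le> 2 * ((sqrt (real n) * b) * frob_norm (X * D) + real n * lam * (1 + \<eta>) / 4 * (a + c))
      + real n * (lam * (a - c))"
    by (rule combine[OF opt' expand cross])
  also have "(sqrt (real n) * b) * frob_norm (X * D) = real n * (b * d)" by (simp add: d)
  also have "2 * (real n * (b * d) + real n * lam * (1 + \<eta>) / 4 * (a + c)) + real n * (lam * (a - c))
      = real n * (2 * b * d + lam * ((3 + \<eta>) / 2 * a - (1 - \<eta>) / 2 * c))"
    by (simp add: field_simps)
  finally show ?thesis using n by simp
qed

text \<open>In the cone, \<open>a\<close> is controlled by the prediction error \<open>d\<close>,
  and the basic inequality, quadratic in \<open>d\<close> on the left and linear on the right,
  bounds \<open>d\<close>. Outside it, 2 b d \<le> d^2 + b^2 eliminates \<open>d\<close> altogether,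
  so the resulting term \<open>b\<^sup>2 / lam\<close> carries no \<kappa>.\<close>

lemma group_lasso_error_bound:
  assumes X: "X \<in> carrier_mat n p" and Y: "Y \<in> carrier_mat n m" and n: "0 < n"
    and T: "T \<in> carrier_mat p m" "T' \<in> carrier_mat p m"
    and S: "S \<subseteq> {..<p}" "card S \<le> s" and zero: "\<And>j. j < p \<Longrightarrow> j \<notin> S \<Longrightarrow> row T' j = 0\<^sub>v m"
    and opt: "(1 / real n) * (frob_norm (Y - X * T))\<^sup>2 + lam * l1l2_norm T
      \<le> (1 / real n) * (frob_norm (Y - X * T'))\<^sup>2 + lam * l1l2_norm T'"
    and lam: "0 < lam" and \<eta>: "\<eta> \<le> 1 / 8" and b: "0 \<le> b"
    and N: "N1 \<in> carrier_mat n m" "N2 \<in> carrier_mat n m" "Y - X * T' = N1 + N2"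
    and N1: "frob_norm N1 \<le> sqrt (real n) * b"
    and N2: "\<And>j. j < p \<Longrightarrow> vec_norm2 (transpose_mat N2 *\<^sub>v col X j) \<le> real n * lam * (1 + \<eta>) / 4"
  defines "\<kappa> \<equiv> restricted_eig n p m X s 4"
  assumes \<kappa>: "0 < \<kappa>"
  shows "l1l2_norm (T - T') \<le> 10 * (b * sqrt (real s) / \<kappa>) + 10 * (lam * real s / \<kappa>\<^sup>2) + 32 * (b\<^sup>2 / lam)"
proof -
  define D where "D = T - T'"
  have D: "D \<in> carrier_mat p m" using T by (auto simp: D_def)
  define d where "d = frob_norm (X * D) / sqrt (real n)"
  define a where "a = (\<Sum>j\<in>S. vec_norm2 (row D j))"
  define c where "c = (\<Sum>j\<in>{..<p} - S. vec_norm2 (row D j))"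
  have nonneg: "0 \<le> a" "0 \<le> c" "0 \<le> d"
    by (auto simp: a_def c_def d_def sum_nonneg)
  have basic: "d\<^sup>2 \<le> 2 * b * d + lam * ((3 + \<eta>) / 2 * a - (1 - \<eta>) / 2 * c)"
    unfolding d_def a_def c_def D_def
    by (rule group_lasso_basic_inequality[OF X Y n T S(1) zero opt lam N N1 N2])
  have total: "l1l2_norm D = a + c"
    using D sum.subset_diff[OF S(1) finite_lessThan, of "\<lambda>j. vec_norm2 (row D j)"]
    by (simp add: l1l2_norm_def a_def c_def)
  have rhs: "0 \<le> b * sqrt (real s) / \<kappa>" "0 \<le> lam * real s / \<kappa>\<^sup>2" "0 \<le> b\<^sup>2 / lam"
    using b lam \<kappa> by auto
  \<comment> \<open>25/16 and 7/16 are the values of (3 + \<eta>)/2 and (1 - \<eta>)/2 at the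
    extreme \<eta> = 1/8.\<close>
  have ha: "(3 + \<eta>) / 2 * a \<le> 25 / 16 * a" using \<eta> nonneg by (intro mult_right_mono) auto
  have hc: "7 / 16 * c \<le> (1 - \<eta>) / 2 * c" using \<eta> nonneg by (intro mult_right_mono) auto
  have basic': "d\<^sup>2 \<le> 2 * b * d + lam * (25 / 16 * a - 7 / 16 * c)"
    using basic mult_left_mono[of "(3 + \<eta>) / 2 * a - (1 - \<eta>) / 2 * c" "25 / 16 * a - 7 / 16 * c" lam]
      ha hc lam by linarith
  \<comment> \<open>The zero matrix is excluded from the cone and so forms its own case.\<close>
  consider "D = 0\<^sub>m p m" | "D \<noteq> 0\<^sub>m p m" "c \<le> 4 * a" | "4 * a < c" by linarith
  then have "a + c \<le> 10 * (b * sqrt (real s) / \<kappa>) + 10 * (lam * real s / \<kappa>\<^sup>2) + 32 * (b\<^sup>2 / lam)"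
  proof cases
    case 1
    have "a + c = 0" unfolding total[symmetric] by (simp add: 1 l1l2_norm_def)
    then show ?thesis using rhs by linarith
  next
    case 2
    then have cone: "D \<in> re_cone p m S 4"
      using D S by (simp add: re_cone_def l1l2_norm_restrict_rows[OF D] a_def c_def)
    have Fd: "\<kappa> * frob_norm (restrict_rows S D) \<le> d"
      using restricted_eig_le[OF S cone n, of X] n by (simp add: \<kappa>_def d_def field_simps)
    have aF: "a \<le> sqrt (real s) * frob_norm (restrict_rows S D)"
      using l1l2_norm_restrict_rows_le_frob[OF D S] by (simp add: a_def l1l2_norm_restrict_rows[OF D S(1)])
    have "\<kappa> * a \<le> \<kappa> * (sqrt (real s) * frob_norm (restrict_rows S D))"
      using \<kappa> by (intro mult_left_mono aF) simp
    also have "\<dots> = sqrt (real s) * (\<kappa> * frob_norm (restrict_rows S D))" by (rule mult.left_commute)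
    also have "\<dots> \<le> sqrt (real s) * d" by (intro mult_left_mono Fd) simp
    finally have "\<kappa> * a \<le> sqrt (real s) * d" .
    then have ad: "a \<le> sqrt (real s) * d / \<kappa>" using \<kappa> by (simp add: field_simps)
    have "d\<^sup>2 \<le> 2 * b * d + lam * (2 * a)"
      using basic' mult_left_mono[of "25 / 16 * a - 7 / 16 * c" "2 * a" lam] nonneg lam by linarith
    also have "lam * (2 * a) \<le> 2 * lam * sqrt (real s) / \<kappa> * d"
      using mult_left_mono[OF ad, of "2 * lam"] lam by (simp add: mult_ac)
    finally have "d * d \<le> (2 * b + 2 * lam * sqrt (real s) / \<kappa>) * d"
      by (simp add: power2_eq_square algebra_simps)
    then have dle: "d \<le> 2 * b + 2 * lam * sqrt (real s) / \<kappa>"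
      using nonneg b lam \<kappa> by (cases "d = 0") auto
    have "a + c \<le> 5 * a" using 2 by simp
    also have "\<dots> \<le> 5 * (sqrt (real s) * d / \<kappa>)" using ad by simp
    also have "\<dots> \<le> 5 * (sqrt (real s) * (2 * b + 2 * lam * sqrt (real s) / \<kappa>) / \<kappa>)"
      using dle \<kappa> by (intro mult_left_mono divide_right_mono) auto
    also have "\<dots> = 10 * (b * sqrt (real s) / \<kappa>) + 10 * (lam * (sqrt (real s) * sqrt (real s)) / \<kappa>\<^sup>2)"
      using \<kappa> by (simp add: field_simps power2_eq_square)
    finally show ?thesis using rhs by simp
  next
    case 3
    \<comment> \<open>For 4 a < c the left side is below (25/64 - 28/64) c = -(6/128) c. The weaker
      5/128 is used because 5/4 c bounds the total a + c.\<close>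
    have "25 / 16 * a - 7 / 16 * c \<le> - (5 / 4) * c / 32"
      using 3 nonneg by simp
    then have "d\<^sup>2 \<le> 2 * b * d + lam * (- (5 / 4) * c / 32)"
      using basic' mult_left_mono[of "25 / 16 * a - 7 / 16 * c" "- (5 / 4) * c / 32" lam] lam by linarith
    moreover have "0 \<le> (d - b)\<^sup>2" by simp
    then have "2 * b * d \<le> d\<^sup>2 + b\<^sup>2" by (simp add: power2_eq_square algebra_simps)
    ultimately have "lam * (5 / 4 * c) \<le> 32 * b\<^sup>2" by simp
    then have "5 / 4 * c \<le> 32 * (b\<^sup>2 / lam)" using lam by (simp add: field_simps)
    then show ?thesis using rhs 3 by linarith
  qed
  then show ?thesis using total by (simp add: D_def)
qed

section \<open>The hidden variable model\<close>

context hidden_variable_model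
begin

text \<open>Coordinate k of E^T x is a weighted sum down column k. Independence is used twice,
  across rows and then across the entries of one row, and leads to the sub-Gaussian constant
  \<gamma>e |x|. For zero \<open>x\<close> this constant is not positive, but then the strict event
  is empty.\<close>

lemma E_tail:
  assumes x: "x \<in> carrier_vec n" and t: "0 < t"
  shows "prob {\<omega> \<in> space M. \<gamma>e * vec_norm2 x * (sqrt (real m) + sqrt (2 * t))
      < vec_norm2 (transpose_mat (E \<omega>) *\<^sub>v x)} \<le> exp (- t)"
proof (cases "x = 0\<^sub>v n")
  case True
  have "transpose_mat (E \<omega>) *\<^sub>v x = 0\<^sub>v m" if "\<omega> \<in> space M" for \<omega>
    using random_matrix_carrier[OF random(2) that] True by auto
  then have "{\<omega> \<in> space M. \<gamma>e * vec_norm2 x * (sqrt (real m) + sqrt (2 * t))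
      < vec_norm2 (transpose_mat (E \<omega>) *\<^sub>v x)} = {}" by (auto simp: True)
  then show ?thesis by (simp only: measure_empty) simp
next
  case False
  then have pos: "0 < \<gamma>e * vec_norm2 x"
    using vec_norm2_eq_0_iff[OF x] gammas by (simp add: less_le)
  define \<xi> where "\<xi> k \<omega> = (\<Sum>i<n. x $ i * E \<omega> $$ (i, k))" for k \<omega>
  have [measurable]: "\<And>i k. i < n \<Longrightarrow> k < m \<Longrightarrow> (\<lambda>\<omega>. E \<omega> $$ (i, k)) \<in> borel_measurable M"
    by (rule random_matrix_entry_measurable[OF random(2)])
  have \<xi> [measurable]: "\<xi> k \<in> borel_measurable M" if "k \<in> {..<m}" for k
    using that unfolding \<xi>_def by (intro borel_measurable_sum borel_measurable_times) auto
  have indep: "indep_vars (\<lambda>_. \<Pi>\<^sub>M k\<in>{..<m}. borel) (row_entries m E) {..<n}"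
    using E_rows_iid by (simp add: iid_def)
  have mgf: "(\<integral>\<^sup>+\<omega>. ennreal (exp (\<Sum>k<m. s k * \<xi> k \<omega>)) \<partial>M)
      \<le> ennreal (exp ((\<gamma>e * vec_norm2 x)\<^sup>2 * (\<Sum>k<m. (s k)\<^sup>2) / 2))" for s
  proof -
    \<comment> \<open>Exchanging the sums collects each row, because independence across
      \<open>i\<close> is given for whole rows.\<close>
    have "(\<Sum>k<m. s k * \<xi> k \<omega>) = (\<Sum>i<n. \<Sum>k<m. (x $ i * s k) * E \<omega> $$ (i, k))" for \<omega>
      unfolding \<xi>_def sum_distrib_left by (subst sum.swap) (simp add: mult_ac)
    then have "(\<integral>\<^sup>+\<omega>. ennreal (exp (\<Sum>k<m. s k * \<xi> k \<omega>)) \<partial>M)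
        = (\<Prod>i<n. \<integral>\<^sup>+\<omega>. ennreal (exp (\<Sum>k<m. (x $ i * s k) * E \<omega> $$ (i, k))) \<partial>M)"
      by (simp only: nn_integral_exp_sum_indep[OF finite_lessThan row_combination_indep[OF indep]])
    also have "\<dots> \<le> (\<Prod>i<n. ennreal (exp (\<gamma>e\<^sup>2 * (x $ i)\<^sup>2 * (\<Sum>k<m. (s k)\<^sup>2) / 2)))"
    proof (rule prod_mono_ennreal)
      fix i assume "i \<in> {..<n}"
      then have i: "i < n" by simp
      have "indep_vars (\<lambda>_. borel) (\<lambda>k \<omega>. (x $ i * s k) * E \<omega> $$ (i, k)) {..<m}"
        by (rule indep_vars_compose2[OF E_entries_indep[OF i]]) simp
      then have "(\<integral>\<^sup>+\<omega>. ennreal (exp (\<Sum>k<m. (x $ i * s k) * E \<omega> $$ (i, k))) \<partial>M)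
          = (\<Prod>k<m. \<integral>\<^sup>+\<omega>. ennreal (exp ((x $ i * s k) * E \<omega> $$ (i, k))) \<partial>M)"
        by (rule nn_integral_exp_sum_indep[OF finite_lessThan])
      also have "\<dots> \<le> (\<Prod>k<m. ennreal (exp (\<gamma>e\<^sup>2 * (x $ i * s k)\<^sup>2 / 2)))"
        by (intro prod_mono_ennreal subgaussian_nn_integral E_subgaussian i) simp
      also have "\<dots> = ennreal (exp (\<Sum>k<m. \<gamma>e\<^sup>2 * (x $ i * s k)\<^sup>2 / 2))"
        by (simp add: exp_sum prod_ennreal)
      also have "(\<Sum>k<m. \<gamma>e\<^sup>2 * (x $ i * s k)\<^sup>2 / 2) = \<gamma>e\<^sup>2 * (x $ i)\<^sup>2 * (\<Sum>k<m. (s k)\<^sup>2) / 2"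
        by (simp add: power_mult_distrib sum_distrib_left sum_divide_distrib mult_ac)
      finally show "(\<integral>\<^sup>+\<omega>. ennreal (exp (\<Sum>k<m. (x $ i * s k) * E \<omega> $$ (i, k))) \<partial>M)
          \<le> ennreal (exp (\<gamma>e\<^sup>2 * (x $ i)\<^sup>2 * (\<Sum>k<m. (s k)\<^sup>2) / 2))" .
    qed
    also have "\<dots> = ennreal (exp (\<Sum>i<n. \<gamma>e\<^sup>2 * (x $ i)\<^sup>2 * (\<Sum>k<m. (s k)\<^sup>2) / 2))"
      by (simp add: exp_sum prod_ennreal)
    also have "(\<Sum>i<n. \<gamma>e\<^sup>2 * (x $ i)\<^sup>2 * (\<Sum>k<m. (s k)\<^sup>2) / 2)
        = (\<gamma>e * vec_norm2 x)\<^sup>2 * (\<Sum>k<m. (s k)\<^sup>2) / 2"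
      unfolding sum_divide_distrib[symmetric] sum_distrib_right[symmetric] sum_distrib_left[symmetric]
      by (simp add: power_mult_distrib vec_norm2_power2_sum[OF x])
    finally show ?thesis .
  qed
  let ?B = "{\<omega> \<in> space M. (\<gamma>e * vec_norm2 x) * (sqrt (real (card {..<m})) + sqrt (2 * t))
      \<le> sqrt (\<Sum>k<m. (\<xi> k \<omega>)\<^sup>2)}"
  have "prob {\<omega> \<in> space M. \<gamma>e * vec_norm2 x * (sqrt (real m) + sqrt (2 * t))
      < vec_norm2 (transpose_mat (E \<omega>) *\<^sub>v x)} \<le> prob ?B"
  proof (rule finite_measure_mono)
    show "?B \<in> events" by measurable
    show "{\<omega> \<in> space M. \<gamma>e * vec_norm2 x * (sqrt (real m) + sqrt (2 * t))
        < vec_norm2 (transpose_mat (E \<omega>) *\<^sub>v x)} \<subseteq> ?B"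
      using vec_norm2_transpose_mult_eq[OF random_matrix_carrier[OF random(2)] x]
      by (auto simp: \<xi>_def)
  qed
  also have "\<dots> \<le> exp (- t)"
    using dims by (intro subgaussian_norm_tail \<xi> mgf pos t) auto
  finally show ?thesis .
qed

text \<open>The vector W R u has its coordinates indexed by rows: by symmetry of \<open>R\<close>,
  coordinate i is u . R W_i, a one-dimensional marginal of the whitened row. \<open>u\<close> ranges
  over the ball since net points need not be unit vectors.\<close>

lemma W_tail:
  assumes R: "is_inv_sqrt K \<Sigma>W R" "\<And>i. i < n \<Longrightarrow> subgaussian_vec K \<gamma>w (\<lambda>\<omega>. R *\<^sub>v row (W \<omega>) i)"
    and u: "u \<in> carrier_vec K" "vec_norm2 u \<le> 1" and t: "0 < t"
  shows "prob {\<omega> \<in> space M. \<gamma>w * (sqrt (real n) + sqrt (2 * t)) \<le> vec_norm2 (W \<omega> *\<^sub>v (R *\<^sub>v u))}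
    \<le> exp (- t)"
proof -
  have Rc: "R \<in> carrier_mat K K" "transpose_mat R = R" using R(1) by (auto simp: is_inv_sqrt_def)
  define y where "y = R *\<^sub>v u"
  have y: "y \<in> carrier_vec K" using Rc u by (simp add: y_def)
  define \<xi> where "\<xi> i \<omega> = (\<Sum>k<K. y $ k * W \<omega> $$ (i, k))" for i \<omega>
  have [measurable]: "\<And>i k. i < n \<Longrightarrow> k < K \<Longrightarrow> (\<lambda>\<omega>. W \<omega> $$ (i, k)) \<in> borel_measurable M"
    by (rule random_matrix_entry_measurable[OF random(1)])
  have \<xi> [measurable]: "\<xi> i \<in> borel_measurable M" if "i \<in> {..<n}" for i
    using that unfolding \<xi>_def by (intro borel_measurable_sum borel_measurable_times) auto
  have indep: "indep_vars (\<lambda>_. \<Pi>\<^sub>M k\<in>{..<K}. borel) (row_entries K W) {..<n}"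
    using W_rows_iid by (simp add: iid_def)
  have \<xi>_eq: "\<xi> i \<omega> = u \<bullet> (R *\<^sub>v row (W \<omega>) i)" if "\<omega> \<in> space M" "i < n" for i \<omega>
  proof -
    have W: "W \<omega> \<in> carrier_mat n K" by (rule random_matrix_carrier[OF random(1) that(1)])
    then have w: "row (W \<omega>) i \<in> carrier_vec K" using that by simp
    have "u \<bullet> (R *\<^sub>v row (W \<omega>) i) = y \<bullet> row (W \<omega>) i"
      using transpose_vec_mult_scalar[OF Rc(1) w u(1)] Rc(2) by (simp add: y_def)
    also have "\<dots> = \<xi> i \<omega>"
      using W w that by (simp add: \<xi>_def scalar_prod_def atLeast0LessThan)
    finally show ?thesis ..
  qed
  have mgf: "(\<integral>\<^sup>+\<omega>. ennreal (exp (\<Sum>i<n. s i * \<xi> i \<omega>)) \<partial>M)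
      \<le> ennreal (exp (\<gamma>w\<^sup>2 * (\<Sum>i<n. (s i)\<^sup>2) / 2))" for s
  proof -
    have "(\<Sum>i<n. s i * \<xi> i \<omega>) = (\<Sum>i<n. \<Sum>k<K. (s i * y $ k) * W \<omega> $$ (i, k))" for \<omega>
      by (simp add: \<xi>_def sum_distrib_left mult_ac)
    then have "(\<integral>\<^sup>+\<omega>. ennreal (exp (\<Sum>i<n. s i * \<xi> i \<omega>)) \<partial>M)
        = (\<Prod>i<n. \<integral>\<^sup>+\<omega>. ennreal (exp (\<Sum>k<K. (s i * y $ k) * W \<omega> $$ (i, k))) \<partial>M)"
      by (simp only: nn_integral_exp_sum_indep[OF finite_lessThan row_combination_indep[OF indep]])
    also have "\<dots> \<le> (\<Prod>i<n. ennreal (exp (\<gamma>w\<^sup>2 * (s i)\<^sup>2 / 2)))"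
    proof (rule prod_mono_ennreal)
      fix i assume "i \<in> {..<n}"
      then have i: "i < n" by simp
      have "(\<integral>\<^sup>+\<omega>. ennreal (exp (\<Sum>k<K. (s i * y $ k) * W \<omega> $$ (i, k))) \<partial>M)
          = (\<integral>\<^sup>+\<omega>. ennreal (exp (s i * (u \<bullet> (R *\<^sub>v row (W \<omega>) i)))) \<partial>M)"
        by (intro nn_integral_cong) (simp add: \<xi>_eq[OF _ i, symmetric] \<xi>_def sum_distrib_left mult_ac)
      also have "\<dots> \<le> ennreal (exp ((\<gamma>w * vec_norm2 u)\<^sup>2 * (s i)\<^sup>2 / 2))"
        using Rc random_matrix_carrier[OF random(1)] i
        by (intro subgaussian_vec_nn_integral[of K] R(2) u(1)) auto
      also have "\<dots> \<le> ennreal (exp (\<gamma>w\<^sup>2 * (s i)\<^sup>2 / 2))"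
      proof -
        have "(\<gamma>w * vec_norm2 u)\<^sup>2 \<le> \<gamma>w\<^sup>2"
          using u(2) gammas by (intro power_mono) (auto simp: mult_le_cancel_left1)
        then show ?thesis by (intro ennreal_leI) (simp add: mult_right_mono)
      qed
      finally show "(\<integral>\<^sup>+\<omega>. ennreal (exp (\<Sum>k<K. (s i * y $ k) * W \<omega> $$ (i, k))) \<partial>M)
          \<le> ennreal (exp (\<gamma>w\<^sup>2 * (s i)\<^sup>2 / 2))" .
    qed
    also have "\<dots> = ennreal (exp (\<Sum>i<n. \<gamma>w\<^sup>2 * (s i)\<^sup>2 / 2))"
      by (simp add: exp_sum prod_ennreal)
    also have "(\<Sum>i<n. \<gamma>w\<^sup>2 * (s i)\<^sup>2 / 2) = \<gamma>w\<^sup>2 * (\<Sum>i<n. (s i)\<^sup>2) / 2"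
      by (simp add: sum_distrib_left sum_divide_distrib)
    finally show ?thesis .
  qed
  have "prob {\<omega> \<in> space M. \<gamma>w * (sqrt (real (card {..<n})) + sqrt (2 * t))
      \<le> sqrt (\<Sum>i<n. (\<xi> i \<omega>)\<^sup>2)} \<le> exp (- t)"
    using dims by (intro subgaussian_norm_tail \<xi> mgf gammas t) auto
  moreover have "{\<omega> \<in> space M. \<gamma>w * (sqrt (real (card {..<n})) + sqrt (2 * t))
      \<le> sqrt (\<Sum>i<n. (\<xi> i \<omega>)\<^sup>2)}
    = {\<omega> \<in> space M. \<gamma>w * (sqrt (real n) + sqrt (2 * t)) \<le> vec_norm2 (W \<omega> *\<^sub>v (R *\<^sub>v u))}"
    using vec_norm2_mult_eq[OF random_matrix_carrier[OF random(1)] y]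
    by (auto simp: \<xi>_def y_def)
  ultimately show ?thesis by simp
qed

text \<open>Each of the p columns of \<open>X\<close> is allotted failure probability \<epsilon> /
  p, the source of the logarithm in \<open>lambda_bar\<close>; for \<open>W\<close> the union runs
  over the net.\<close>

lemma noise_event:
  assumes R: "is_inv_sqrt K \<Sigma>W R" "\<And>i. i < n \<Longrightarrow> subgaussian_vec K \<gamma>w (\<lambda>\<omega>. R *\<^sub>v row (W \<omega>) i)"
    and \<epsilon>: "0 < \<epsilon>" "\<epsilon> < 1"
  shows "\<exists>G\<in>events. prob G \<ge> 1 - \<epsilon> - exp (- real K) \<and>
    (\<forall>\<omega>\<in>G. (\<forall>j<p. vec_norm2 (transpose_mat (E \<omega>) *\<^sub>v col X j)
        \<le> \<gamma>e * vec_norm2 (col X j) * (sqrt (real m) + sqrt (2 * ln (real p / \<epsilon>)))) \<and>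
      op_norm (W \<omega> * R) \<le> 8 * \<gamma>w * (sqrt (real n) + sqrt (real K)))"
proof -
  have Rc: "R \<in> carrier_mat K K" using R(1) by (simp add: is_inv_sqrt_def)
  define t where "t = ln (real p / \<epsilon>)"
  have "\<epsilon> < real p" using \<epsilon> dims by linarith
  then have t: "0 < t" "exp (- t) = \<epsilon> / real p"
    using \<epsilon> dims by (simp_all add: t_def exp_minus)
  \<comment> \<open>The union over at most \<open>exp (6 * real K)\<close> net points then leaves
    \<open>exp (- real K)\<close>.\<close>
  define t' where "t' = 7 * real K"
  have t': "0 < t'" using dims by (simp add: t'_def)
  define BE where "BE j = {\<omega> \<in> space M. \<gamma>e * vec_norm2 (col X j) * (sqrt (real m) + sqrt (2 * t))
      < vec_norm2 (transpose_mat (E \<omega>) *\<^sub>v col X j)}" for j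
  define BW where "BW z = {\<omega> \<in> space M. \<gamma>w * (sqrt (real n) + sqrt (2 * t'))
      \<le> vec_norm2 (W \<omega> *\<^sub>v (R *\<^sub>v net_vec K z))}" for z
  have colX: "col X j \<in> carrier_vec n" for j using carriers(1) by auto
  have Rz: "R *\<^sub>v net_vec K z \<in> carrier_vec K" for z using Rc by simp
  have [measurable]: "(\<lambda>\<omega>. vec_norm2 (transpose_mat (E \<omega>) *\<^sub>v col X j)) \<in> borel_measurable M" for j
    by (rule vec_norm2_transpose_mult_measurable[OF random(2) colX])
  have [measurable]: "(\<lambda>\<omega>. vec_norm2 (W \<omega> *\<^sub>v (R *\<^sub>v net_vec K z))) \<in> borel_measurable M" for z
    by (rule vec_norm2_mult_measurable[OF random(1) Rz])
  have BE [measurable]: "BE j \<in> events" for j unfolding BE_def by measurable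
  have BW [measurable]: "BW z \<in> events" for z unfolding BW_def by measurable
  define UE where "UE = (\<Union>j\<in>{..<p}. BE j)"
  define UW where "UW = (\<Union>z\<in>lattice_net K. BW z)"
  have UE: "UE \<in> events" unfolding UE_def by measurable
  have UW: "UW \<in> events" unfolding UW_def using finite_lattice_net by (intro sets.finite_UN) auto
  have "prob UE \<le> (\<Sum>j<p. prob (BE j))" unfolding UE_def by (intro measure_UNION_le) auto
  also have "\<dots> \<le> (\<Sum>j<p. \<epsilon> / real p)"
    using E_tail[OF colX t(1)] by (intro sum_mono) (simp add: BE_def t(2))
  also have "\<dots> = \<epsilon>" using dims by simp
  finally have pUE: "prob UE \<le> \<epsilon>" .
  have "prob UW \<le> (\<Sum>z\<in>lattice_net K. prob (BW z))"
    unfolding UW_def using finite_lattice_net by (intro measure_UNION_le) auto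
  also have "\<dots> \<le> (\<Sum>z\<in>lattice_net K. exp (- t'))"
    unfolding BW_def by (intro sum_mono W_tail R net_vec_carrier net_vec_norm_le dims t')
  also have "\<dots> = real (card (lattice_net K)) * exp (- t')" by simp
  also have "\<dots> \<le> exp (6 * real K) * exp (- t')"
    by (intro mult_right_mono card_lattice_net_le) simp
  also have "\<dots> = exp (- real K)" by (simp add: t'_def exp_add[symmetric])
  finally have pUW: "prob UW \<le> exp (- real K)" .
  define G where "G = space M - (UE \<union> UW)"
  show ?thesis
  proof (intro bexI[of _ G] conjI ballI allI impI)
    show "G \<in> events" using UE UW by (auto simp: G_def)
    have "prob G = 1 - prob (UE \<union> UW)"
      unfolding G_def using UE UW by (intro prob_compl) auto
    moreover have "prob (UE \<union> UW) \<le> prob UE + prob UW" by (rule measure_Un_le[OF UE UW])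
    ultimately show "prob G \<ge> 1 - \<epsilon> - exp (- real K)" using pUE pUW by linarith
  next
    fix \<omega> j assume "\<omega> \<in> G" "j < p"
    then have "\<omega> \<in> space M" "\<omega> \<notin> BE j" by (auto simp: G_def UE_def)
    then show "vec_norm2 (transpose_mat (E \<omega>) *\<^sub>v col X j)
        \<le> \<gamma>e * vec_norm2 (col X j) * (sqrt (real m) + sqrt (2 * ln (real p / \<epsilon>)))"
      by (simp add: BE_def t_def not_less)
  next
    fix \<omega> assume "\<omega> \<in> G"
    then have \<omega>: "\<omega> \<in> space M" "\<And>z. z \<in> lattice_net K \<Longrightarrow> \<omega> \<notin> BW z" by (auto simp: G_def UW_def)
    have W: "W \<omega> \<in> carrier_mat n K" by (rule random_matrix_carrier[OF random(1) \<omega>(1)])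
    have WR: "W \<omega> * R \<in> carrier_mat n K" using W Rc by simp
    have "op_norm (W \<omega> * R) \<le> 2 * (\<gamma>w * (sqrt (real n) + sqrt (2 * t')))"
    proof (rule op_norm_le_net[OF WR])
      fix z assume "z \<in> lattice_net K"
      then have "\<omega> \<notin> BW z" by (rule \<omega>(2))
      then have "vec_norm2 (W \<omega> *\<^sub>v (R *\<^sub>v net_vec K z)) \<le> \<gamma>w * (sqrt (real n) + sqrt (2 * t'))"
        using \<omega>(1) by (simp add: BW_def)
      then show "vec_norm2 (W \<omega> * R *\<^sub>v net_vec K z) \<le> \<gamma>w * (sqrt (real n) + sqrt (2 * t'))"
        by (simp only: assoc_mult_mat_vec[OF W Rc net_vec_carrier])
    qed (rule dims)
    \<comment> \<open>14 K \<le> 16 K; the resulting 4, doubled by the passage from the net to the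
      operator norm, is the constant 8.\<close>
    also have "sqrt (2 * t') \<le> 4 * sqrt (real K)"
      by (rule real_le_lsqrt) (auto simp: t'_def power_mult_distrib)
    also have "2 * (\<gamma>w * (sqrt (real n) + 4 * sqrt (real K))) \<le> 8 * \<gamma>w * (sqrt (real n) + sqrt (real K))"
      using gammas by (simp add: algebra_simps)
    finally show "op_norm (W \<omega> * R) \<le> 8 * \<gamma>w * (sqrt (real n) + sqrt (real K))"
      using gammas by simp
  qed
qed

section \<open>Whitening of the hidden signal\<close>

lemma \<Sigma>W_symmetric: "\<Sigma>W \<in> carrier_mat K K" "transpose_mat \<Sigma>W = \<Sigma>W"
proof -
  have eq: "\<Sigma>W = row_cov K W 0" using W_cov[of 0] dims by simp
  show "\<Sigma>W \<in> carrier_mat K K" unfolding eq by (simp add: row_cov_def)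
  show "transpose_mat \<Sigma>W = \<Sigma>W"
    unfolding eq by (intro eq_matI) (auto simp: row_cov_def mult.commute)
qed

text \<open>The vector y = R \<Sigma>W B v plays the role of the square root of \<Sigma>W applied to
  B v, without such a root being introduced. As R R inverts \<Sigma>W, R y = B v and |y|^2 = B v .
  \<Sigma>W B v, which is the form of B^T \<Sigma>W B at \<open>v\<close>.\<close>

lemma whitened_signal:
  assumes R: "is_inv_sqrt K \<Sigma>W R" and v: "v \<in> carrier_vec m"
  shows "(vec_norm2 (R *\<^sub>v (\<Sigma>W *\<^sub>v (B *\<^sub>v v))))\<^sup>2
      \<le> largest_eigenvalue (transpose_mat B * \<Sigma>W * B) * (vec_norm2 v)\<^sup>2"
    and "\<omega> \<in> space M \<Longrightarrow> (W \<omega> * B) *\<^sub>v v = (W \<omega> * R) *\<^sub>v (R *\<^sub>v (\<Sigma>W *\<^sub>v (B *\<^sub>v v)))"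
proof -
  have Rc: "R \<in> carrier_mat K K" "transpose_mat R = R" "\<Sigma>W * (R * R) = 1\<^sub>m K"
    using R by (auto simp: is_inv_sqrt_def)
  note S = \<Sigma>W_symmetric
  have B: "B \<in> carrier_mat K m" "transpose_mat B \<in> carrier_mat m K" using carriers by auto
  have RR: "R * R \<in> carrier_mat K K" using Rc by simp
  have RRS: "R * R * \<Sigma>W = 1\<^sub>m K"
    by (rule mat_mult_left_right_inverse[OF S(1) RR Rc(3)])
  define b where "b = B *\<^sub>v v"
  define x where "x = \<Sigma>W *\<^sub>v b"
  define y where "y = R *\<^sub>v x"
  have b: "b \<in> carrier_vec K" using B v by (simp add: b_def)
  have x: "x \<in> carrier_vec K" using S b by (simp add: x_def)
  have y: "y \<in> carrier_vec K" using Rc x by (simp add: y_def)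
  have Ry: "R *\<^sub>v y = b"
  proof -
    have "R *\<^sub>v y = (R * R) *\<^sub>v x" unfolding y_def by (rule assoc_mult_mat_vec[OF Rc(1) Rc(1) x, symmetric])
    also have "\<dots> = (R * R * \<Sigma>W) *\<^sub>v b" unfolding x_def by (rule assoc_mult_mat_vec[OF RR S(1) b, symmetric])
    finally show ?thesis using b by (simp add: RRS)
  qed
  have H: "transpose_mat B * \<Sigma>W * B \<in> carrier_mat m m" using B S by simp
  have BS: "transpose_mat B * \<Sigma>W \<in> carrier_mat m K" using B S by simp
  have HT: "transpose_mat (transpose_mat B * \<Sigma>W * B) = transpose_mat B * \<Sigma>W * B"
    unfolding transpose_mult[OF BS B(1)] transpose_mult[OF B(2) S(1)] S(2)
    using assoc_mult_mat[OF B(2) S(1) B(1)] by simp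
  have "(vec_norm2 y)\<^sup>2 = y \<bullet> (R *\<^sub>v x)" by (simp add: vec_norm2_power2 y_def)
  also have "\<dots> = (transpose_mat R *\<^sub>v y) \<bullet> x" by (rule transpose_vec_mult_scalar[OF Rc(1) x y, symmetric])
  also have "\<dots> = b \<bullet> x" by (simp add: Rc(2) Ry)
  also have "\<dots> = x \<bullet> (B *\<^sub>v v)" unfolding b_def[symmetric] by (rule comm_scalar_prod[OF b x])
  also have "\<dots> = (transpose_mat B *\<^sub>v x) \<bullet> v" by (rule transpose_vec_mult_scalar[OF B(1) v x, symmetric])
  also have "transpose_mat B *\<^sub>v x = (transpose_mat B * \<Sigma>W * B) *\<^sub>v v"
    using assoc_mult_mat_vec[OF BS B(1) v] assoc_mult_mat_vec[OF B(2) S(1) b] by (simp add: x_def b_def)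
  also have "((transpose_mat B * \<Sigma>W * B) *\<^sub>v v) \<bullet> v = v \<bullet> ((transpose_mat B * \<Sigma>W * B) *\<^sub>v v)"
    using H v by (intro comm_scalar_prod[of _ m]) auto
  also have "\<dots> \<le> largest_eigenvalue (transpose_mat B * \<Sigma>W * B) * (vec_norm2 v)\<^sup>2"
    by (rule quadratic_form_le_largest_eigenvalue[OF H HT dims(3) v])
  finally show "(vec_norm2 (R *\<^sub>v (\<Sigma>W *\<^sub>v (B *\<^sub>v v))))\<^sup>2
      \<le> largest_eigenvalue (transpose_mat B * \<Sigma>W * B) * (vec_norm2 v)\<^sup>2"
    by (simp only: y_def x_def b_def)
  assume "\<omega> \<in> space M"
  then have W: "W \<omega> \<in> carrier_mat n K" by (rule random_matrix_carrier[OF random(1)])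
  show "(W \<omega> * B) *\<^sub>v v = (W \<omega> * R) *\<^sub>v (R *\<^sub>v (\<Sigma>W *\<^sub>v (B *\<^sub>v v)))"
    unfolding assoc_mult_mat_vec[OF W B(1) v] b_def[symmetric] x_def[symmetric] y_def[symmetric]
      assoc_mult_mat_vec[OF W Rc(1) y] Ry ..
qed

text \<open>The preceding bound is tested on a unit vector. Nonnegativity matters because
  \<open>sqrt\<close> of a negative real is negative in HOL.\<close>

lemma largest_eigenvalue_signal_nonneg:
  assumes R: "is_inv_sqrt K \<Sigma>W R"
  shows "0 \<le> largest_eigenvalue (transpose_mat B * \<Sigma>W * B)"
proof -
  have "0 \<le> (vec_norm2 (R *\<^sub>v (\<Sigma>W *\<^sub>v (B *\<^sub>v unit_vec m 0))))\<^sup>2" by simp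
  also have "\<dots> \<le> largest_eigenvalue (transpose_mat B * \<Sigma>W * B) * (vec_norm2 (unit_vec m 0))\<^sup>2"
    by (rule whitened_signal(1)[OF R]) simp
  also have "(vec_norm2 (unit_vec m 0 :: real vec))\<^sup>2 = 1" using dims by (simp add: vec_norm2_power2)
  finally show ?thesis by simp
qed

lemma hidden_signal_le:
  assumes R: "is_inv_sqrt K \<Sigma>W R" and v: "v \<in> carrier_vec m" and \<omega>: "\<omega> \<in> space M"
  shows "vec_norm2 ((W \<omega> * B) *\<^sub>v v)
    \<le> op_norm (W \<omega> * R) * sqrt (largest_eigenvalue (transpose_mat B * \<Sigma>W * B)) * vec_norm2 v"
proof -
  let ?\<Lambda> = "largest_eigenvalue (transpose_mat B * \<Sigma>W * B)"
  let ?y = "R *\<^sub>v (\<Sigma>W *\<^sub>v (B *\<^sub>v v))"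
  have Rc: "R \<in> carrier_mat K K" using R by (auto simp: is_inv_sqrt_def)
  have W: "W \<omega> \<in> carrier_mat n K" by (rule random_matrix_carrier[OF random(1) \<omega>])
  have y: "?y \<in> carrier_vec K" using Rc \<Sigma>W_symmetric(1) carriers v by simp
  have "sqrt ((vec_norm2 ?y)\<^sup>2) \<le> sqrt (?\<Lambda> * (vec_norm2 v)\<^sup>2)"
    by (intro real_sqrt_le_mono whitened_signal(1) R v)
  then have "vec_norm2 ?y \<le> sqrt ?\<Lambda> * vec_norm2 v" by (simp add: real_sqrt_mult)
  then have "op_norm (W \<omega> * R) * vec_norm2 ?y \<le> op_norm (W \<omega> * R) * (sqrt ?\<Lambda> * vec_norm2 v)"
    by (rule mult_left_mono) simp
  moreover have "vec_norm2 ((W \<omega> * R) *\<^sub>v ?y) \<le> op_norm (W \<omega> * R) * vec_norm2 ?y"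
    by (rule vec_norm2_le_op_norm[OF mult_carrier_mat[OF W Rc] y])
  ultimately show ?thesis unfolding whitened_signal(2)[OF R v \<omega>] by (simp add: mult.assoc)
qed

end

section \<open>Algebra of the residual and of the estimated projection\<close>

lemma add_minus_swap_mat:
  fixes A :: "'a :: ab_group_add mat"
  assumes "A \<in> carrier_mat r c" "B \<in> carrier_mat r c" "C \<in> carrier_mat r c"
  shows "(A + B) - C = (A - C) + B"
  using assms by (intro eq_matI) auto

text \<open>Let \<open>M0\<close> be the signal part X F + W B. From B (I - P) = 0 it follows that
  M0 (I - P) = X \<Psi> (I - P), the target; subtracting this from M0 (I - Q) leaves M0 (P -
  Q).\<close>

lemma residual_decomposition:
  fixes B P Q :: "real mat"
  assumes X: "X \<in> carrier_mat n p" and \<Psi>: "\<Psi> \<in> carrier_mat p m" and A: "A \<in> carrier_mat p k"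
    and B: "B \<in> carrier_mat k m" and W: "W \<in> carrier_mat n k" and E: "E \<in> carrier_mat n m"
    and P: "P \<in> carrier_mat m m" "B * P = B" and Q: "Q \<in> carrier_mat m m"
  shows "(X * (\<Psi> + A * B) + (W * B + E)) * (1\<^sub>m m - Q) - X * (\<Psi> * (1\<^sub>m m - P))
    = (X * (\<Psi> + A * B) + W * B) * (P - Q) + E * (1\<^sub>m m - Q)"
proof -
  define F where "F = \<Psi> + A * B"
  have F: "F \<in> carrier_mat p m" using \<Psi> A B by (simp add: F_def)
  define I where "I = (1\<^sub>m m :: real mat)"
  have I: "I \<in> carrier_mat m m" by (simp add: I_def)
  have IP: "I - P \<in> carrier_mat m m" "I - Q \<in> carrier_mat m m" "P - Q \<in> carrier_mat m m"
    using P Q by (simp_all add: minus_carrier_mat)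
  have BIP: "B * (I - P) = 0\<^sub>m k m"
  proof -
    have "B * (I - P) = B * I - B * P" by (rule mult_minus_distrib_mat[OF B I P(1)])
    also have "\<dots> = B - B" using B P by (simp add: I_def)
    also have "\<dots> = 0\<^sub>m k m" using B by simp
    finally show ?thesis .
  qed
  have FP: "F * (I - P) = \<Psi> * (I - P)"
  proof -
    have "F * (I - P) = \<Psi> * (I - P) + A * B * (I - P)"
      unfolding F_def using A B by (intro add_mult_distrib_mat[OF \<Psi> _ IP(1)]) simp
    also have "A * B * (I - P) = A * (B * (I - P))" by (rule assoc_mult_mat[OF A B IP(1)])
    also have "\<dots> = 0\<^sub>m p m" using A by (simp add: BIP)
    finally show ?thesis using \<Psi> IP by simp
  qed
  define M0 where "M0 = X * F + W * B"
  have M0: "M0 \<in> carrier_mat n m" using X F W B by (simp add: M0_def)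
  have XF: "X * F \<in> carrier_mat n m" and WB: "W * B \<in> carrier_mat n m" using X F W B by simp_all
  have M0P: "M0 * (I - P) = X * (\<Psi> * (I - P))"
  proof -
    have "M0 * (I - P) = X * F * (I - P) + W * B * (I - P)"
      unfolding M0_def by (rule add_mult_distrib_mat[OF XF WB IP(1)])
    also have "W * B * (I - P) = W * (B * (I - P))" by (rule assoc_mult_mat[OF W B IP(1)])
    also have "\<dots> = 0\<^sub>m n m" using W by (simp add: BIP)
    also have "X * F * (I - P) = X * (F * (I - P))" by (rule assoc_mult_mat[OF X F IP(1)])
    finally show ?thesis using X \<Psi> IP by (simp add: FP)
  qed
  have PQ: "P - Q = (I - Q) - (I - P)" using P Q I by (intro eq_matI) auto
  have M0PQ: "M0 * (P - Q) = M0 * (I - Q) - X * (\<Psi> * (I - P))"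
    unfolding PQ M0P[symmetric] by (rule mult_minus_distrib_mat[OF M0 IP(2) IP(1)])
  have YM: "X * F + (W * B + E) = M0 + E"
    unfolding M0_def by (rule assoc_add_mat[OF XF WB E, symmetric])
  have YQ: "(X * F + (W * B + E)) * (I - Q) = M0 * (I - Q) + E * (I - Q)"
    unfolding YM by (rule add_mult_distrib_mat[OF M0 E IP(2)])
  have c: "M0 * (I - Q) \<in> carrier_mat n m" "E * (I - Q) \<in> carrier_mat n m" "X * (\<Psi> * (I - P)) \<in> carrier_mat n m"
    using M0 E X \<Psi> IP by auto
  have "(M0 * (I - Q) + E * (I - Q)) - X * (\<Psi> * (I - P)) = (M0 * (I - Q) - X * (\<Psi> * (I - P))) + E * (I - Q)"
    by (rule add_minus_swap_mat[OF c])
  then show ?thesis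
    unfolding F_def[symmetric] I_def[symmetric] M0_def[symmetric] YQ M0PQ .
qed

text \<open>\<open>Q\<close> need not be symmetric, hence the transpose, which is (I - P) minus the
  transpose of Q - P. The case \<open>P\<close> = \<open>Q\<close> is used as well, when the
  estimator is itself an orthogonal projection.\<close>

lemma vec_norm2_perturbed_complement_le:
  assumes P: "P \<in> carrier_mat m m" "transpose_mat P = P" "P * P = P" and Q: "Q \<in> carrier_mat m m"
    and v: "v \<in> carrier_vec m"
  shows "vec_norm2 (transpose_mat (1\<^sub>m m - Q) *\<^sub>v v) \<le> (1 + frob_norm (Q - P)) * vec_norm2 v"
proof -
  have PQ: "Q - P \<in> carrier_mat m m" "1\<^sub>m m - P \<in> carrier_mat m m" "transpose_mat (Q - P) \<in> carrier_mat m m"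
    using P Q by (simp_all add: minus_carrier_mat)
  have "transpose_mat (1\<^sub>m m - Q) = (1\<^sub>m m - P) - transpose_mat (Q - P)"
  proof (rule eq_matI)
    fix i j assume "i < dim_row ((1\<^sub>m m - P) - transpose_mat (Q - P))" "j < dim_col ((1\<^sub>m m - P) - transpose_mat (Q - P))"
    then have ij: "i < m" "j < m" using PQ by auto
    have "P $$ (j, i) = P $$ (i, j)" using P ij by (metis carrier_matD index_transpose_mat(1))
    then show "transpose_mat (1\<^sub>m m - Q) $$ (i, j) = ((1\<^sub>m m - P) - transpose_mat (Q - P)) $$ (i, j)"
      using ij P Q by auto
  qed (use P Q in auto)
  then have "transpose_mat (1\<^sub>m m - Q) *\<^sub>v v = (1\<^sub>m m - P) *\<^sub>v v - transpose_mat (Q - P) *\<^sub>v v"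
    by (simp only: minus_mult_distrib_mat_vec[OF PQ(2,3) v])
  also have "\<dots> = (1\<^sub>m m - P) *\<^sub>v v + (-1) \<cdot>\<^sub>v (transpose_mat (Q - P) *\<^sub>v v)"
    using PQ v by (intro eq_vecI) auto
  finally have "vec_norm2 (transpose_mat (1\<^sub>m m - Q) *\<^sub>v v)
      \<le> vec_norm2 ((1\<^sub>m m - P) *\<^sub>v v) + vec_norm2 ((-1) \<cdot>\<^sub>v (transpose_mat (Q - P) *\<^sub>v v))"
    using PQ v by (simp only:) (intro vec_norm2_triangle[of _ m], auto)
  also have "vec_norm2 ((1\<^sub>m m - P) *\<^sub>v v) \<le> vec_norm2 v"
    by (rule vec_norm2_projection_complement_le[OF P v])
  also have "vec_norm2 ((-1) \<cdot>\<^sub>v (transpose_mat (Q - P) *\<^sub>v v)) \<le> frob_norm (Q - P) * vec_norm2 v"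
    using vec_norm2_mult_mat_vec_le_frob[OF PQ(3) v] by (simp add: vec_norm2_smult)
  finally show ?thesis by (simp add: algebra_simps)
qed

lemma frob_norm_minus_commute:
  assumes "A \<in> carrier_mat r c" "B \<in> carrier_mat r c"
  shows "frob_norm (A - B) = frob_norm (B - A)"
  using assms by (auto simp: frob_norm_def power2_commute intro!: sum.cong)

text \<open>Lets the error term linear in the rate be absorbed into the maximum of the final
  bound.\<close>

lemma le_max_square_div:
  fixes x y :: real
  assumes "0 < y"
  shows "x \<le> max y (x\<^sup>2 / y)"
proof (cases "x \<le> y")
  case False
  then have "x * y \<le> x\<^sup>2" using assms by (simp add: power2_eq_square)
  then have "x \<le> x\<^sup>2 / y" using assms by (simp add: field_simps)
  then show ?thesis by simp
qed simp

context hidden_variable_model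
begin

section \<open>Penalty level and assembly of the bound\<close>

lemma vec_norm2_col_le_sample_cov:
  assumes "j < p"
  shows "vec_norm2 (col X j) = sqrt (real n) * sqrt (sample_cov n X $$ (j, j))"
    and "sample_cov n X $$ (j, j) \<le> Max ((\<lambda>j. sample_cov n X $$ (j, j)) ` {..<p})"
proof -
  have "sample_cov n X $$ (j, j) = (1 / real n) * (vec_norm2 (col X j))\<^sup>2"
    using carriers(1) assms by (simp add: sample_cov_def vec_norm2_power2)
  then show "vec_norm2 (col X j) = sqrt (real n) * sqrt (sample_cov n X $$ (j, j))"
    using dims by (simp add: real_sqrt_divide)
  show "sample_cov n X $$ (j, j) \<le> Max ((\<lambda>j. sample_cov n X $$ (j, j)) ` {..<p})"
    using assms by (intro Max_ge) auto
qed

text \<open>The sqrt n in the length of a column and the 1 / sqrt n inside \<open>lambda_bar\<close>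
  combine to the factor n.\<close>

lemma vec_norm2_col_le_lambda_bar:
  assumes j: "j < p" and \<epsilon>: "0 < \<epsilon>" "\<epsilon> < 1"
  shows "\<gamma>e * vec_norm2 (col X j) * (sqrt (real m) + sqrt (2 * ln (real p / \<epsilon>))) * 4
    \<le> real n * lambda_bar n p m X \<gamma>e \<epsilon>"
proof -
  define mx where "mx = Max ((\<lambda>j. sample_cov n X $$ (j, j)) ` {..<p})"
  define h where "h = sqrt (real m) + sqrt (2 * ln (real p / \<epsilon>))"
  have "\<epsilon> < real p" using \<epsilon> dims by linarith
  then have h: "0 \<le> h" using \<epsilon> by (simp add: h_def)
  have "vec_norm2 (col X j) \<le> sqrt (real n) * sqrt mx"
    unfolding vec_norm2_col_le_sample_cov(1)[OF j] mx_def
    by (intro mult_left_mono real_sqrt_le_mono vec_norm2_col_le_sample_cov(2) j) simp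
  then have "\<gamma>e * vec_norm2 (col X j) * h * 4 \<le> \<gamma>e * (sqrt (real n) * sqrt mx) * h * 4"
    using h gammas by (intro mult_right_mono mult_left_mono) auto
  also have "\<dots> = real n * (4 * \<gamma>e * sqrt mx * (h / sqrt (real n)))"
    using dims by (simp add: field_simps)
  finally show ?thesis by (simp add: lambda_bar_def mx_def h_def)
qed

lemma lambda_bar_pos:
  assumes "0 < restricted_eig n p m X s 4" "0 < \<epsilon>" "\<epsilon> < 1"
  shows "0 < lambda_bar n p m X \<gamma>e \<epsilon>"
proof -
  obtain j where j: "j < p" "col X j \<noteq> 0\<^sub>v n"
    using restricted_eig_pos_imp_nonzero_col[OF carriers(1) dims(1-3) sparsity(1) assms(1)] .
  have "0 < vec_norm2 (col X j)"
    by (rule vec_norm2_pos[OF _ j(2)]) (use carriers(1) in auto)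
  moreover have "\<epsilon> < real p" using assms dims by linarith
  then have "0 < ln (real p / \<epsilon>)" using assms by simp
  then have "0 < sqrt (real m) + sqrt (2 * ln (real p / \<epsilon>))" using dims by (intro add_pos_pos) auto
  ultimately have "0 < \<gamma>e * vec_norm2 (col X j) * (sqrt (real m) + sqrt (2 * ln (real p / \<epsilon>))) * 4"
    using gammas by (intro mult_pos_pos) auto
  also have "\<dots> \<le> real n * lambda_bar n p m X \<gamma>e \<epsilon>"
    by (rule vec_norm2_col_le_lambda_bar[OF j(1) assms(2,3)])
  finally show ?thesis by (simp add: zero_less_mult_iff)
qed

text \<open>The deterministic part, for one fixed outcome. \<open>C\<^sub>1\<close> dominates both
  \<open>C\<^sub>0\<close> and \<open>8 * \<gamma>w * C\<^sub>0\<close>, so the design part and the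
  hidden part of the bias share one constant.\<close>

lemma error_bound:
  fixes C\<^sub>0 \<xi> \<epsilon> lam :: real
  assumes \<kappa>: "0 < restricted_eig n p m X s 4" and \<epsilon>: "0 < \<epsilon>" "\<epsilon> < 1"
    and lam: "lambda_bar n p m X \<gamma>e \<epsilon> \<le> lam" and C\<^sub>0: "0 < C\<^sub>0" and \<xi>: "0 \<le> \<xi>"
    and R: "is_inv_sqrt K \<Sigma>W R" and \<omega>: "\<omega> \<in> space M"
    and EX: "\<And>j. j < p \<Longrightarrow> vec_norm2 (transpose_mat (E \<omega>) *\<^sub>v col X j)
      \<le> \<gamma>e * vec_norm2 (col X j) * (sqrt (real m) + sqrt (2 * ln (real p / \<epsilon>)))"
    and WR: "op_norm (W \<omega> * R) \<le> 8 * \<gamma>w * (sqrt (real n) + sqrt (real K))"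
    and Q: "Q \<in> carrier_mat m m" "frob_norm (Q - row_space_proj B) \<le> C\<^sub>0 * \<xi>"
    and Q': "C\<^sub>0 * \<xi> \<le> 1 / 8 \<or> orth_projection m Q"
    and sol: "is_group_lasso_solution n p m X (response X \<Psi> A B (W \<omega>) (E \<omega>)) Q lam \<Theta>"
  defines "C\<^sub>1 \<equiv> max 1 (8 * \<gamma>w) * C\<^sub>0"
  shows "l1l2_norm (\<Theta> - Theta_star m \<Psi> B)
    \<le> (10 * C\<^sub>1 + 10 + 32 * C\<^sub>1\<^sup>2) * (max lam ((lambda_tilde n p m K s X \<Psi> A B \<Sigma>W \<xi>)\<^sup>2 / lam) *
        (real s / (restricted_eig n p m X s 4)\<^sup>2))"
proof -
  define P where "P = row_space_proj B"
  note P = row_space_proj[OF carriers(4) rank_B, folded P_def]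
  have Wc: "W \<omega> \<in> carrier_mat n K" and Ec: "E \<omega> \<in> carrier_mat n m"
    using random_matrix_carrier[OF random(1) \<omega>] random_matrix_carrier[OF random(2) \<omega>] .
  define F where "F = \<Psi> + A * B"
  have F: "F \<in> carrier_mat p m" using carriers by (simp add: F_def)
  define \<Lambda> where "\<Lambda> = largest_eigenvalue (transpose_mat B * \<Sigma>W * B)"
  have \<Lambda>: "0 \<le> \<Lambda>" unfolding \<Lambda>_def by (rule largest_eigenvalue_signal_nonneg[OF R])
  define \<kappa> where "\<kappa> = restricted_eig n p m X s 4"
  have \<kappa>_pos: "0 < \<kappa>" using \<kappa> by (simp add: \<kappa>_def)
  have lam_pos: "0 < lam" using lambda_bar_pos[OF \<kappa> \<epsilon>] lam by linarith
  have C\<^sub>1: "0 < C\<^sub>1" "C\<^sub>0 \<le> C\<^sub>1" "8 * \<gamma>w * C\<^sub>0 \<le> C\<^sub>1"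
    using C\<^sub>0 by (auto simp: C\<^sub>1_def mult_le_cancel_right)
  \<comment> \<open>This is \<open>lambda_tilde\<close> without its factor \<kappa> / sqrt s; sqrt n
    \<open>C\<^sub>1\<close> g will bound the bias in Frobenius norm.\<close>
  define g where "g = ((1 / sqrt (real n)) * op_norm (X * F) + sqrt \<Lambda> * (1 + sqrt (real K / real n))) * \<xi>"
  have g: "0 \<le> g" using \<Lambda> \<xi> by (simp add: g_def)
  define Y where "Y = response X \<Psi> A B (W \<omega>) (E \<omega>) * (1\<^sub>m m - Q)"
  define T' where "T' = Theta_star m \<Psi> B"
  define M0 where "M0 = X * F + W \<omega> * B"
  define N1 where "N1 = M0 * (P - Q)"
  define N2 where "N2 = E \<omega> * (1\<^sub>m m - Q)"
  have IQ: "1\<^sub>m m - Q \<in> carrier_mat m m" "P - Q \<in> carrier_mat m m" "1\<^sub>m m - P \<in> carrier_mat m m"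
    using P(1) Q(1) by (simp_all add: minus_carrier_mat)
  have XF: "X * F \<in> carrier_mat n m" and WB: "W \<omega> * B \<in> carrier_mat n m"
    using carriers F Wc by simp_all
  have M0: "M0 \<in> carrier_mat n m" using WB by (simp add: M0_def)
  have Y: "Y \<in> carrier_mat n m"
    unfolding Y_def response_def coef_def F_def[symmetric]
    by (rule mult_carrier_mat[OF _ IQ(1)]) (use XF WB Ec in simp)
  have N: "N1 \<in> carrier_mat n m" "N2 \<in> carrier_mat n m" using M0 IQ Ec by (auto simp: N1_def N2_def)
  have T': "T' \<in> carrier_mat p m" using carriers IQ by (simp add: T'_def Theta_star_def P_def[symmetric])
  have resid: "Y - X * T' = N1 + N2"
    unfolding Y_def T'_def N1_def N2_def M0_def F_def response_def coef_def Theta_star_def P_def[symmetric]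
    by (rule residual_decomposition[OF carriers(1-4) Wc Ec P(1,4) Q(1)])
  have \<Theta>: "\<Theta> \<in> carrier_mat p m"
    and opt: "(1 / real n) * (frob_norm (Y - X * \<Theta>))\<^sup>2 + lam * l1l2_norm \<Theta>
      \<le> (1 / real n) * (frob_norm (Y - X * T'))\<^sup>2 + lam * l1l2_norm T'"
    using sol T' unfolding is_group_lasso_solution_def is_arg_min_def Y_def[symmetric]
    by (auto simp: not_less)
  define S where "S = {j. j < p \<and> row \<Psi> j \<noteq> 0\<^sub>v m}"
  have S: "S \<subseteq> {..<p}" "card S \<le> s" using sparsity(3) by (auto simp: S_def)
  have zero: "row T' j = 0\<^sub>v m" if "j < p" "j \<notin> S" for j
  proof (rule eq_vecI)
    fix k assume "k < dim_vec (0\<^sub>v m :: real vec)"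
    then have k: "k < m" by simp
    have "T' $$ (j, k) = row \<Psi> j \<bullet> col (1\<^sub>m m - P) k"
      using that k carriers P(1) by (simp add: T'_def Theta_star_def P_def[symmetric])
    also have "row \<Psi> j = 0\<^sub>v m" using that by (simp add: S_def)
    also have "0\<^sub>v m \<bullet> col (1\<^sub>m m - P) k = 0"
      by (rule scalar_prod_left_zero) (rule carrier_vecI, use P(1) in simp)
    finally show "row T' j $ k = 0\<^sub>v m $ k" using T' that k by simp
  qed (use T' in simp)
  have N1_le: "frob_norm N1 \<le> sqrt (real n) * (C\<^sub>1 * g)"
  proof -
    define q where "q = op_norm (X * F) + 8 * \<gamma>w * (sqrt (real n) + sqrt (real K)) * sqrt \<Lambda>"
    have q: "0 \<le> q" using gammas \<Lambda> by (simp add: q_def)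
    have "frob_norm N1 \<le> q * frob_norm (P - Q)"
      unfolding N1_def
    proof (rule frob_norm_mult_le[OF M0 IQ(2) q])
      fix v :: "real vec" assume v: "v \<in> carrier_vec m"
      have "M0 *\<^sub>v v = (X * F) *\<^sub>v v + (W \<omega> * B) *\<^sub>v v"
        unfolding M0_def by (rule add_mult_distrib_mat_vec[OF XF WB v])
      then have "vec_norm2 (M0 *\<^sub>v v) \<le> vec_norm2 ((X * F) *\<^sub>v v) + vec_norm2 ((W \<omega> * B) *\<^sub>v v)"
        using vec_norm2_triangle[OF mult_mat_vec_carrier[OF XF v] mult_mat_vec_carrier[OF WB v]] by simp
      also have "vec_norm2 ((X * F) *\<^sub>v v) \<le> op_norm (X * F) * vec_norm2 v"
        by (rule vec_norm2_le_op_norm[OF XF v])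
      also have "vec_norm2 ((W \<omega> * B) *\<^sub>v v) \<le> op_norm (W \<omega> * R) * sqrt \<Lambda> * vec_norm2 v"
        unfolding \<Lambda>_def by (rule hidden_signal_le[OF R v \<omega>])
      also have "\<dots> \<le> 8 * \<gamma>w * (sqrt (real n) + sqrt (real K)) * sqrt \<Lambda> * vec_norm2 v"
        using \<Lambda> by (intro mult_right_mono WR) auto
      finally show "vec_norm2 (M0 *\<^sub>v v) \<le> q * vec_norm2 v" by (simp add: q_def algebra_simps)
    qed
    also have "frob_norm (P - Q) \<le> C\<^sub>0 * \<xi>"
      using Q(2) frob_norm_minus_commute[OF P(1) Q(1)] by (simp add: P_def)
    also have "q * (C\<^sub>0 * \<xi>) = (C\<^sub>0 * op_norm (X * F) + 8 * \<gamma>w * C\<^sub>0 * ((sqrt (real n) + sqrt (real K)) * sqrt \<Lambda>)) * \<xi>"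
      by (simp add: q_def algebra_simps)
    also have "\<dots> \<le> (C\<^sub>1 * op_norm (X * F) + C\<^sub>1 * ((sqrt (real n) + sqrt (real K)) * sqrt \<Lambda>)) * \<xi>"
      using C\<^sub>1 \<Lambda> \<xi> by (intro mult_right_mono add_mono) auto
    also have "\<dots> = sqrt (real n) * (C\<^sub>1 * g)"
      using dims by (simp add: g_def real_sqrt_divide field_simps)
    finally show ?thesis using q by (simp add: mult_left_mono)
  qed
  \<comment> \<open>Both branches give at most 1/8: a projection causes no excess, whatever the size
    of \<xi>, and otherwise the first alternative of \<open>Q'\<close> holds.\<close>
  define \<eta> where "\<eta> = (if orth_projection m Q then 0 else C\<^sub>0 * \<xi>)"
  have \<eta>: "\<eta> \<le> 1 / 8" "0 \<le> \<eta>" using Q' C\<^sub>0 \<xi> by (auto simp: \<eta>_def)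
  have N2_le: "vec_norm2 (transpose_mat N2 *\<^sub>v col X j) \<le> real n * lam * (1 + \<eta>) / 4" if j: "j < p" for j
  proof -
    define v where "v = transpose_mat (E \<omega>) *\<^sub>v col X j"
    have x: "col X j \<in> carrier_vec n" using carriers(1) by auto
    have ET: "transpose_mat (E \<omega>) \<in> carrier_mat m n" "transpose_mat (1\<^sub>m m - Q) \<in> carrier_mat m m"
      using Ec IQ by simp_all
    have v: "v \<in> carrier_vec m" using ET x unfolding v_def by (intro mult_mat_vec_carrier)
    have "vec_norm2 (transpose_mat N2 *\<^sub>v col X j) = vec_norm2 (transpose_mat (1\<^sub>m m - Q) *\<^sub>v v)"
      unfolding N2_def transpose_mult[OF Ec IQ(1)] v_def
      by (rule arg_cong[OF assoc_mult_mat_vec[OF ET(2,1) x]])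
    also have "vec_norm2 (transpose_mat (1\<^sub>m m - Q) *\<^sub>v v) \<le> (1 + \<eta>) * vec_norm2 v"
    proof (cases "orth_projection m Q")
      case True
      have "frob_norm (Q - Q) = 0" by (simp add: frob_norm_def)
      then show ?thesis
        using vec_norm2_perturbed_complement_le[of Q m Q v] True Q(1) v
        by (simp add: orth_projection_def \<eta>_def)
    next
      case False
      have "vec_norm2 (transpose_mat (1\<^sub>m m - Q) *\<^sub>v v) \<le> (1 + frob_norm (Q - P)) * vec_norm2 v"
        by (rule vec_norm2_perturbed_complement_le[OF P(1-3) Q(1) v])
      also have "\<dots> \<le> (1 + \<eta>) * vec_norm2 v"
        using False Q(2) by (intro mult_right_mono) (auto simp: \<eta>_def P_def)
      finally show ?thesis .
    qed
    also have "(1 + \<eta>) * vec_norm2 v \<le> (1 + \<eta>) * (real n * lam / 4)"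
    proof (rule mult_left_mono)
      have "vec_norm2 v * 4 \<le> real n * lambda_bar n p m X \<gamma>e \<epsilon>"
        using EX[OF j] vec_norm2_col_le_lambda_bar[OF j \<epsilon>] unfolding v_def by linarith
      also have "\<dots> \<le> real n * lam" using lam by (intro mult_left_mono) auto
      finally show "vec_norm2 v \<le> real n * lam / 4" by simp
    qed (use \<eta> in simp)
    finally show ?thesis by (simp add: mult_ac)
  qed
  have bound: "l1l2_norm (\<Theta> - T')
      \<le> 10 * (C\<^sub>1 * g * sqrt (real s) / \<kappa>) + 10 * (lam * real s / \<kappa>\<^sup>2) + 32 * ((C\<^sub>1 * g)\<^sup>2 / lam)"
    unfolding \<kappa>_def
    by (rule group_lasso_error_bound[OF carriers(1) Y dims(1) \<Theta> T' S zero opt lam_pos \<eta>(1) _ N resid N1_le N2_le \<kappa>])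
      (use C\<^sub>1 g in auto)
  define lt where "lt = lambda_tilde n p m K s X \<Psi> A B \<Sigma>W \<xi>"
  have "lt = g * (\<kappa> / sqrt (real s))"
    by (simp add: lt_def lambda_tilde_def g_def coef_def F_def \<Lambda>_def \<kappa>_def)
  moreover have s: "0 < real s" using sparsity by simp
  ultimately have g_eq: "g = lt * sqrt (real s) / \<kappa>" using \<kappa>_pos by (simp add: field_simps)
  \<comment> \<open>Substituting g = lt sqrt s / \<kappa> makes all three terms of
    \<open>bound\<close> multiples of this common factor.\<close>
  define r where "r = real s / \<kappa>\<^sup>2"
  have r: "0 \<le> r" by (simp add: r_def)
  define mx where "mx = max lam (lt\<^sup>2 / lam)"
  have "C\<^sub>1 * g * sqrt (real s) / \<kappa> = C\<^sub>1 * (lt * r)"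
    using s \<kappa>_pos by (simp add: g_eq r_def field_simps power2_eq_square)
  moreover have "(C\<^sub>1 * g)\<^sup>2 / lam = C\<^sub>1\<^sup>2 * (lt\<^sup>2 / lam * r)"
    using s by (simp add: g_eq r_def power_mult_distrib power_divide)
  moreover have "lam * real s / \<kappa>\<^sup>2 = lam * r" by (simp add: r_def)
  moreover have "C\<^sub>1 * (lt * r) \<le> C\<^sub>1 * (mx * r)"
    using C\<^sub>1 r le_max_square_div[OF lam_pos, of lt] unfolding mx_def
    by (intro mult_left_mono mult_right_mono) auto
  moreover have "lam * r \<le> mx * r" using r by (intro mult_right_mono) (auto simp: mx_def)
  moreover have "C\<^sub>1\<^sup>2 * (lt\<^sup>2 / lam * r) \<le> C\<^sub>1\<^sup>2 * (mx * r)"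
    using r by (intro mult_left_mono mult_right_mono) (auto simp: mx_def)
  ultimately have "l1l2_norm (\<Theta> - T') \<le> 10 * (C\<^sub>1 * (mx * r)) + 10 * (mx * r) + 32 * (C\<^sub>1\<^sup>2 * (mx * r))"
    using bound by linarith
  also have "\<dots> = (10 * C\<^sub>1 + 10 + 32 * C\<^sub>1\<^sup>2) * (mx * r)" by (simp add: algebra_simps)
  finally show ?thesis by (simp only: T'_def mx_def lt_def r_def \<kappa>_def)
qed

end

text \<open>The closeness of \<open>Phat\<close> is a premise inside \<open>G\<close>, so the
  probability bound concerns the noise alone. A proper sequence is read as \<xi> below a threshold
  depending on the constants only, or any \<xi> for a projection-valued estimator.\<close>

theorem theorem6:
  fixes \<gamma>w \<gamma>e C\<^sub>0 :: real
  assumes "0 < \<gamma>w" and "0 < \<gamma>e" and "0 < C\<^sub>0"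
  shows "\<exists>C>0. \<exists>c>0. \<exists>\<xi>\<^sub>0>0.
    \<forall>(M :: 'w measure) n p m K s X \<Psi> A B \<Sigma>W W E \<tau> \<epsilon> lam \<xi> Phat.
      hidden_variable_model M n p m K s X \<Psi> A B \<Sigma>W W E \<tau> \<gamma>w \<gamma>e \<longrightarrow>
      restricted_eig n p m X s 4 > 0 \<longrightarrow>
      0 < \<epsilon> \<longrightarrow> \<epsilon> < 1 \<longrightarrow>
      lam \<ge> lambda_bar n p m X \<gamma>e \<epsilon> \<longrightarrow>
      random_matrix M m m Phat \<longrightarrow>
      0 \<le> \<xi> \<longrightarrow>
      \<xi> \<le> \<xi>\<^sub>0 \<or> (\<forall>\<omega>\<in>space M. orth_projection m (Phat \<omega>)) \<longrightarrow>
      (\<exists>G\<in>sets M.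
         measure M G \<ge> 1 - \<epsilon> - 2 * exp (- c * real K) \<and>
         (\<forall>\<omega>\<in>G. frob_norm (Phat \<omega> - row_space_proj B) \<le> C\<^sub>0 * \<xi> \<longrightarrow>
            (\<forall>\<Theta>. is_group_lasso_solution n p m X
                   (response X \<Psi> A B (W \<omega>) (E \<omega>)) (Phat \<omega>) lam \<Theta> \<longrightarrow>
               l1l2_norm (\<Theta> - Theta_star m \<Psi> B) \<le>
                 C * (max lam ((lambda_tilde n p m K s X \<Psi> A B \<Sigma>W \<xi>)\<^sup>2 / lam) *
                      (real s / (restricted_eig n p m X s 4)\<^sup>2)))))"
proof -
  define C\<^sub>1 where "C\<^sub>1 = max 1 (8 * \<gamma>w) * C\<^sub>0"
  have "0 < C\<^sub>1" using assms by (simp add: C\<^sub>1_def)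
  then have C: "0 < 10 * C\<^sub>1 + 10 + 32 * C\<^sub>1\<^sup>2" by (simp add: add_pos_nonneg)
  show ?thesis
  proof (intro exI conjI allI impI)
    \<comment> \<open>The coefficients 10, 10 and 32 are those of the three terms in
      \<open>group_lasso_error_bound\<close>.\<close>
    show "0 < 10 * C\<^sub>1 + 10 + 32 * C\<^sub>1\<^sup>2" by (rule C)
    show "0 < (1 :: real)" by simp
    \<comment> \<open>Below this threshold \<open>C\<^sub>0 * \<xi>\<close> is at most 1/8, the
      excess tolerated by \<open>group_lasso_error_bound\<close>.\<close>
    show "0 < 1 / (8 * C\<^sub>0)" using assms by simp
    fix M :: "'w measure" and n p m K s X \<Psi> A B \<Sigma>W W E \<tau> \<epsilon> lam \<xi> Phat
    assume "hidden_variable_model M n p m K s X \<Psi> A B \<Sigma>W W E \<tau> \<gamma>w \<gamma>e"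
    then interpret hidden_variable_model M n p m K s X \<Psi> A B \<Sigma>W W E \<tau> \<gamma>w \<gamma>e .
    assume \<kappa>: "restricted_eig n p m X s 4 > 0" and \<epsilon>: "0 < \<epsilon>" "\<epsilon> < 1"
      and lam: "lam \<ge> lambda_bar n p m X \<gamma>e \<epsilon>" and Phat: "random_matrix M m m Phat"
      and \<xi>: "0 \<le> \<xi>" and small: "\<xi> \<le> 1 / (8 * C\<^sub>0) \<or> (\<forall>\<omega>\<in>space M. orth_projection m (Phat \<omega>))"
    obtain R where R: "is_inv_sqrt K \<Sigma>W R"
        "\<And>i. i < n \<Longrightarrow> subgaussian_vec K \<gamma>w (\<lambda>\<omega>. R *\<^sub>v row (W \<omega>) i)"
      using W_subgaussian by blast
    obtain G where G: "G \<in> events" "prob G \<ge> 1 - \<epsilon> - exp (- real K)"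
      and G_bounds: "\<forall>\<omega>\<in>G. (\<forall>j<p. vec_norm2 (transpose_mat (E \<omega>) *\<^sub>v col X j)
          \<le> \<gamma>e * vec_norm2 (col X j) * (sqrt (real m) + sqrt (2 * ln (real p / \<epsilon>)))) \<and>
        op_norm (W \<omega> * R) \<le> 8 * \<gamma>w * (sqrt (real n) + sqrt (real K))"
      using noise_event[OF R(1) _ \<epsilon>] R(2) by blast
    have "l1l2_norm (\<Theta> - Theta_star m \<Psi> B) \<le>
        (10 * C\<^sub>1 + 10 + 32 * C\<^sub>1\<^sup>2) * (max lam ((lambda_tilde n p m K s X \<Psi> A B \<Sigma>W \<xi>)\<^sup>2 / lam) *
          (real s / (restricted_eig n p m X s 4)\<^sup>2))"
      if "\<omega> \<in> G" "frob_norm (Phat \<omega> - row_space_proj B) \<le> C\<^sub>0 * \<xi>"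
        "is_group_lasso_solution n p m X (response X \<Psi> A B (W \<omega>) (E \<omega>)) (Phat \<omega>) lam \<Theta>" for \<omega> \<Theta>
    proof -
      have \<omega>: "\<omega> \<in> space M" using sets.sets_into_space[OF G(1)] that(1) by blast
      have "C\<^sub>0 * \<xi> \<le> 1 / 8 \<or> orth_projection m (Phat \<omega>)"
        using small \<omega> assms(3) by (auto simp: field_simps)
      then show ?thesis
        unfolding C\<^sub>1_def using G_bounds that(1)
        by (intro error_bound[OF \<kappa> \<epsilon> lam assms(3) \<xi> R(1) \<omega> _ _
              random_matrix_carrier[OF Phat \<omega>] that(2) _ that(3)]) auto
    qed
    moreover have "1 - \<epsilon> - 2 * exp (- 1 * real K) \<le> prob G"
      using G(2) by (simp add: order_trans[rotated])
    ultimately show "\<exists>G\<in>sets M.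
         measure M G \<ge> 1 - \<epsilon> - 2 * exp (- 1 * real K) \<and>
         (\<forall>\<omega>\<in>G. frob_norm (Phat \<omega> - row_space_proj B) \<le> C\<^sub>0 * \<xi> \<longrightarrow>
            (\<forall>\<Theta>. is_group_lasso_solution n p m X
                   (response X \<Psi> A B (W \<omega>) (E \<omega>)) (Phat \<omega>) lam \<Theta> \<longrightarrow>
               l1l2_norm (\<Theta> - Theta_star m \<Psi> B) \<le>
                 (10 * C\<^sub>1 + 10 + 32 * C\<^sub>1\<^sup>2) * (max lam ((lambda_tilde n p m K s X \<Psi> A B \<Sigma>W \<xi>)\<^sup>2 / lam) *
                      (real s / (restricted_eig n p m X s 4)\<^sup>2))))"
      using G(1) by blast
  qed
qed

end
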